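(* There is an absolute constant $C>0$ such that the following holds. For all integers $n\ge 2$, every prime power $q$, every real $\sigma>0$, and every integer $m \ge C\left(1+\frac{\sigma+\log_2 q}{\log_2 n}\right)$, the split and mix protocol with $n$ parties, $m$ messages per party and inputs in $\mathbb{F}_q$ is $\sigma$-secure; that is, for all $\mathbf{x},\mathbf{x}'\in\mathbb{F}_q^n$ with $\sum_{i=1}^n x_i=\sum_{i=1}^n x'_i$ we have $\mathrm{SD}(\mathcal{S}_{\mathbf{x}},\mathcal{S}_{\mathbf{x}'})\le 2^{-\sigma}$.
   Context: $\mathbb{F}_q$ is the finite field with $q$ elements and $\mathrm{SD}$ denotes statistical (total variation) distance. Split and mix protocol: each party $i$ holding $x_i\in\mathbb{F}_q$ sends $m$ anonymous messages $y_1,\dots,y_m\in\mathbb{F}_q$, where $y_1,\dots,y_{m-1}$ are independent uniform elements of $\mathbb{F}_q$ and $y_m=x_i-\sum_{j<m}y_j$. For $\mathbf{x}\in\mathbb{F}_q^n$, $\mathcal{S}_{\mathbf{x}}$ is the distribution on $\mathbb{F}_q^{mn}$ obtained by sampling, independently for each $i\in[n]$, $y_{m(i-1)+1},\dots,y_{mi}\in\mathbb{F}_q$ uniformly at random conditioned on $y_{m(i-1)+1}+\cdots+y_{mi}=x_i$, then sampling a uniformly random permutation $\pi$ of $[mn]$ and outputting $(y_{\pi(1)},\dots,y_{\pi(mn)})$. *)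

theory Defs
  imports "HOL-Probability.Probability" "HOL-Algebra.Ring"
begin

text \<open>The finite field is an HOL-Algebra field R whose carrier consists of natural numbers
  (every finite field is isomorphic to such a one); this lets the absolute constant C be
  quantified before the field.\<close>

fun rsum :: "('a, 'b) ring_scheme \<Rightarrow> 'a list \<Rightarrow> 'a" where
  "rsum R [] = \<zero>\<^bsub>R\<^esub>"
| "rsum R (y # ys) = y \<oplus>\<^bsub>R\<^esub> rsum R ys"

definition shares :: "('a, 'b) ring_scheme \<Rightarrow> nat \<Rightarrow> 'a \<Rightarrow> 'a list set" where
  "shares R m a = {ys. length ys = m \<and> set ys \<subseteq> carrier R \<and> rsum R ys = a}"

definition split_pmf :: "('a, 'b) ring_scheme \<Rightarrow> nat \<Rightarrow> 'a \<Rightarrow> 'a list pmf" where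
  "split_pmf R m a = pmf_of_set (shares R m a)"

fun split_all :: "('a, 'b) ring_scheme \<Rightarrow> nat \<Rightarrow> 'a list \<Rightarrow> 'a list pmf" where
  "split_all R m [] = return_pmf []"
| "split_all R m (a # as) =
     bind_pmf (split_pmf R m a) (\<lambda>ys. bind_pmf (split_all R m as) (\<lambda>zs. return_pmf (ys @ zs)))"

definition shuffle_pmf :: "'a list \<Rightarrow> 'a list pmf" where
  "shuffle_pmf ys = map_pmf (\<lambda>\<pi>. map (\<lambda>k. ys ! \<pi> k) [0..<length ys])
      (pmf_of_set {\<pi>. \<pi> permutes {..<length ys}})"

definition split_mix :: "('a, 'b) ring_scheme \<Rightarrow> nat \<Rightarrow> 'a list \<Rightarrow> 'a list pmf" where
  "split_mix R m x = bind_pmf (split_all R m x) shuffle_pmf"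

definition stat_dist :: "'a pmf \<Rightarrow> 'a pmf \<Rightarrow> real" where
  "stat_dist p q = (1/2) * (\<Sum>\<^sub>\<infinity> z. \<bar>pmf p z - pmf q z\<bar>)"

end

theory Submission
  imports Defs "HOL-Combinatorics.Multiset_Permutations"
begin

text \<open>By Cauchy--Schwarz it suffices to bound the collision probability of the output
  distribution, compared with the uniform distribution on the \<open>mn\<close>-tuples of the right sum. Let \<open>B\<close> be the
  set of unshuffled outputs. The collision probability is the average over permutations \<open>\<pi>\<close> of
  the number of \<open>y \<in> B\<close> with \<open>\<pi> y \<in> B\<close>, divided by \<open>|B|\<^sup>2\<close>. This number is at most the size of
  the kernel of a linear map, and the kernel of the transposed map consists of pairs \<open>(f, g)\<close> of
  labellings of the \<open>n\<close> blocks by field elements such that \<open>\<pi>\<close> carries the block-constant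
  extension of \<open>f\<close> to that of \<open>g\<close>. For fixed \<open>f\<close> and \<open>g\<close> with the same multiset \<open>A\<close> of labels this happens for a
  fraction \<open>1 / N(m \<cdot> A)\<close> of all \<open>\<pi>\<close>, where \<open>N\<close> counts the arrangements of a multiset. Since
  \<open>N(m \<cdot> A) \<ge> N(A)\<^sup>m\<close>, everything reduces to bounding the sum of \<open>N(A)\<close> to the power \<open>2 - m\<close> over all
  multisets \<open>A\<close> of \<open>n\<close> labels. The \<open>q\<close> constant multisets give the main term, and the others are
  controlled by \<open>N(A)\<^sup>2 \<ge> n ^ (s - 1)\<close> for \<open>A\<close> with \<open>s\<close> distinct labels.\<close>

subsection \<open>Arrangements of multisets\<close>

text \<open>Raising \<open>d\<close> by one multiplies the left side by the new \<open>d\<close> and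
  the right side by \<open>c + d - 1\<close> for the new \<open>d\<close>, which is at least as
  large because \<open>c \<ge> 1\<close>.\<close>

lemma fact_mult_fact_le:
  assumes "c \<ge> 1" "d \<ge> 1"
  shows "fact c * fact d \<le> (fact (c + d - 1) :: nat)"
proof -
  obtain d' where d: "d = Suc d'" using assms by (cases d) auto
  have "fact c * fact (Suc d') \<le> (fact (c + d') :: nat)" for d'
  proof (induction d')
    case (Suc k)
    have "fact c * fact (Suc (Suc k)) = (fact c * fact (Suc k)) * (Suc (Suc k) :: nat)"
      by (simp add: algebra_simps)
    also have "\<dots> \<le> fact (c + k) * (Suc (c + k))"
      using Suc assms(1) by (intro mult_mono) auto
    finally show ?case by (simp add: algebra_simps)
  qed simp
  thus ?thesis by (simp add: d)
qed

text \<open>For a fixed total, a product of factorials of positive numbers is largest when all but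
  one of them equal 1; the remaining one is then the total plus 1 minus the number of factors. The
  induction merges one value at a time by \<open>fact_mult_fact_le\<close>.\<close>

lemma prod_fact_le:
  assumes "finite S" "S \<noteq> {}" "\<And>x. x \<in> S \<Longrightarrow> f x \<ge> (1::nat)"
  shows "(\<Prod>x\<in>S. fact (f x)) \<le> (fact (sum f S + 1 - card S) :: nat)"
  using assms
proof (induction S rule: finite_ne_induct)
  case (insert x F)
  have le: "card F \<le> sum f F"
    using sum_mono[of F "\<lambda>_. 1" f] insert by auto
  have "(\<Prod>y\<in>insert x F. fact (f y)) = fact (f x) * (\<Prod>y\<in>F. fact (f y) :: nat)"
    using insert by simp
  also have "\<dots> \<le> fact (f x) * fact (sum f F + 1 - card F)"
    using insert by (intro mult_left_mono) auto
  also have "\<dots> \<le> fact (f x + (sum f F + 1 - card F) - 1)"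
    using insert le by (intro fact_mult_fact_le) auto
  also have "f x + (sum f F + 1 - card F) - 1 = sum f (insert x F) + 1 - card (insert x F)"
    using insert le by simp
  finally show ?case .
qed simp

lemma fact_eq_falling_prod:
  "t \<le> n \<Longrightarrow> fact n = (\<Prod>i<t. n - i) * (fact (n - t) :: nat)"
proof (induction t)
  case (Suc t)
  hence "fact n = (\<Prod>i<t. n - i) * (fact (n - t) :: nat)" by simp
  also have "fact (n - t) = (n - t) * (fact (n - Suc t) :: nat)"
    using Suc.prems by (metis Suc_diff_Suc Suc_le_lessD fact_Suc of_nat_id)
  finally show ?case by simp
qed simp

text \<open>Pairing the factor \<open>n - i\<close> with \<open>n - (t - 1 - i)\<close> gives a product of at least \<open>n\<close>.\<close>

lemma falling_prod_square_ge:
  assumes "t \<le> (n::nat)"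
  shows "n ^ t \<le> (\<Prod>i<t. n - i)\<^sup>2"
proof -
  have "(\<Prod>i<t. n - i)\<^sup>2 = (\<Prod>i<t. n - i) * (\<Prod>i<t. n - (t - Suc i))"
    using prod.nat_diff_reindex[of "\<lambda>i. n - i" t] by (simp add: power2_eq_square)
  also have "\<dots> = (\<Prod>i<t. (n - i) * (n - (t - Suc i)))"
    by (simp add: prod.distrib)
  also have "\<dots> \<ge> (\<Prod>i<t. n)"
  proof (intro prod_mono conjI)
    fix i assume i: "i \<in> {..<t}"
    define j where "j = t - Suc i"
    define d where "d = n - t"
    have n: "n = i + j + 1 + d" using i assms unfolding j_def d_def by auto
    have "(n - i) * (n - j) = (j + 1 + d) * (i + 1 + d)" unfolding n by simp
    also have "\<dots> \<ge> n" unfolding n by (simp add: algebra_simps)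
    finally show "n \<le> (n - i) * (n - (t - Suc i))" unfolding j_def .
  qed auto
  finally show ?thesis by simp
qed

text \<open>The multinomial formula divides \<open>n!\<close> by the product of the factorials of
  the multiplicities, which is at most \<open>(n - s + 1)!\<close>. Hence the number of arrangements
  is at least the falling product of \<open>s - 1\<close> factors starting at \<open>n\<close>, and
  \<open>falling_prod_square_ge\<close> applies.\<close>

lemma card_permutations_of_multiset_square_ge:
  fixes A :: "'a multiset"
  assumes "A \<noteq> {#}"
  shows "size A ^ (card (set_mset A) - 1) \<le> card (permutations_of_multiset A) ^ 2"
proof -
  define n s where "n = size A" and "s = card (set_mset A)"
  define N where "N = card (permutations_of_multiset A)"
  have s: "s \<ge> 1" using assms by (simp add: s_def Suc_leI card_gt_0_iff)
  have n: "n = (\<Sum>x\<in>set_mset A. count A x)" by (simp add: n_def size_multiset_overloaded_eq)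
  have sn: "s \<le> n"
    using sum_mono[of "set_mset A" "\<lambda>_. 1" "count A"] by (auto simp: n s_def)
  let ?P = "\<Prod>x\<in>set_mset A. fact (count A x) :: nat"
  have P: "?P \<le> fact (n + 1 - s)"
    unfolding n s_def using assms by (intro prod_fact_le) auto
  have "N * ?P = fact n"
    unfolding N_def n_def using card_permutations_of_multiset[of A] by simp
  hence "(\<Prod>i<s - 1. n - i) * fact (n - (s - 1)) = N * ?P"
    using fact_eq_falling_prod[of "s - 1" n] sn by simp
  also have "\<dots> \<le> N * fact (n - (s - 1))"
    using P s sn by (intro mult_left_mono) auto
  finally have "(\<Prod>i<s - 1. n - i) \<le> N" by simp
  hence "(\<Prod>i<s - 1. n - i)\<^sup>2 \<le> N\<^sup>2" by (intro power_mono) auto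
  moreover have "n ^ (s - 1) \<le> (\<Prod>i<s - 1. n - i)\<^sup>2"
    using sn by (intro falling_prod_square_ge) auto
  ultimately show ?thesis unfolding N_def n_def s_def by (rule le_trans[rotated])
qed

text \<open>Concatenation is injective here, since all arrangements of \<open>A\<close> have the
  same length and the cut can be recovered.\<close>

lemma card_permutations_of_multiset_union_ge:
  "card (permutations_of_multiset A) * card (permutations_of_multiset B)
     \<le> card (permutations_of_multiset (A + B))"
proof -
  have "inj_on (\<lambda>(xs, ys). xs @ ys) (permutations_of_multiset A \<times> permutations_of_multiset B)"
    by (rule inj_onI) (auto simp: length_finite_permutations_of_multiset)
  moreover have "(\<lambda>(xs, ys). xs @ ys) ` (permutations_of_multiset A \<times> permutations_of_multiset B)
      \<subseteq> permutations_of_multiset (A + B)"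
    by (auto simp: permutations_of_multiset_def)
  ultimately show ?thesis
    unfolding card_cartesian_product[symmetric] by (rule card_inj_on_le) simp
qed

lemma card_permutations_of_multiset_repeat_ge:
  "card (permutations_of_multiset A) ^ m \<le> card (permutations_of_multiset (repeat_mset m A))"
proof (induction m)
  case (Suc m)
  have "card (permutations_of_multiset A) ^ Suc m
      \<le> card (permutations_of_multiset A) * card (permutations_of_multiset (repeat_mset m A))"
    using Suc by simp
  also have "\<dots> \<le> card (permutations_of_multiset (repeat_mset (Suc m) A))"
    using card_permutations_of_multiset_union_ge[of A "repeat_mset m A"] by simp
  finally show ?case .
qed simp

text \<open>Orbit counting: the symmetric group acts transitively on the arrangements of
  \<open>mset xs\<close>, so all of them are reached from \<open>xs\<close> by equally many
  permutations.\<close>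

lemma card_permutations_permuting_to:
  fixes xs ys :: "'a list"
  assumes "mset ys = mset xs"
  shows "card {\<pi>. \<pi> permutes {..<length xs} \<and> permute_list \<pi> xs = ys}
           * card (permutations_of_multiset (mset xs)) = fact (length xs)"
proof -
  let ?Pi = "{\<pi>. \<pi> permutes {..<length xs}}"
  define F where "F ys = {\<pi>. \<pi> permutes {..<length xs} \<and> permute_list \<pi> xs = ys}" for ys
  have finPi: "finite ?Pi" by (simp add: finite_permutations)
  \<comment> \<open>Composing with a permutation \<open>p\<close> that carries \<open>zs\<close> to
    \<open>ys\<close> maps \<open>F zs\<close> injectively into \<open>F ys\<close>. Used in both
    directions this gives equality.\<close>
  have le: "card (F zs) \<le> card (F ys)"
    if zs: "mset zs = mset xs" and ys: "mset ys = mset xs" for ys zs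
  proof -
    have len: "length zs = length xs" using zs by (rule mset_eq_length)
    obtain p where p: "p permutes {..<length zs}" "permute_list p zs = ys"
      using mset_eq_permutation[of ys zs] zs ys by metis
    show ?thesis
    proof (rule card_inj_on_le[where f = "\<lambda>\<pi>. \<pi> \<circ> p"])
      show "inj_on (\<lambda>\<pi>. \<pi> \<circ> p) (F zs)"
        using permutes_surj[OF p(1)] by (intro inj_onI) (metis fun.inj_map_strong surj_fun_eq)
      show "(\<lambda>\<pi>. \<pi> \<circ> p) ` F zs \<subseteq> F ys"
        using p len by (auto simp: F_def permute_list_compose permutes_compose)
      show "finite (F ys)" by (rule finite_subset[OF _ finPi]) (auto simp: F_def)
    qed
  qed
  have "card ?Pi = (\<Sum>zs\<in>permutations_of_multiset (mset xs). card (F zs))"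
  proof -
    have "?Pi = (\<Union>zs\<in>permutations_of_multiset (mset xs). F zs)"
      by (auto simp: F_def permutations_of_multiset_def)
    also have "card \<dots> = (\<Sum>zs\<in>permutations_of_multiset (mset xs). card (F zs))"
      by (intro card_UN_disjoint) (auto simp: F_def intro: finite_subset[OF _ finPi])
    finally show ?thesis .
  qed
  also have "\<dots> = (\<Sum>zs\<in>permutations_of_multiset (mset xs). card (F ys))"
    using le assms by (intro sum.cong refl antisym) (auto simp: permutations_of_multiset_def)
  finally show ?thesis
    by (simp add: card_permutations F_def mult.commute)
qed

subsection \<open>Vectors over a finite field\<close>

definition vecs :: "('a, 'b) ring_scheme \<Rightarrow> nat \<Rightarrow> 'a list set" where
  "vecs R N = {u. length u = N \<and> set u \<subseteq> carrier R}"

definition dot :: "('a, 'b) ring_scheme \<Rightarrow> 'a list \<Rightarrow> 'a list \<Rightarrow> 'a" where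
  "dot R u v = rsum R (map2 (\<otimes>\<^bsub>R\<^esub>) u v)"

text \<open>This linear map recovers the inputs of the \<open>n\<close> parties from their
  concatenated messages.\<close>

fun block_sums :: "('a, 'b) ring_scheme \<Rightarrow> nat \<Rightarrow> nat \<Rightarrow> 'a list \<Rightarrow> 'a list" where
  "block_sums R m 0 y = []"
| "block_sums R m (Suc n) y = rsum R (take m y) # block_sums R m n (drop m y)"

text \<open>The block-constant extension of a labelling of the blocks. With respect to
  \<open>dot\<close> it is the transpose of \<open>block_sums\<close>, by
  \<open>dot_block_sums\<close>.\<close>

definition inflate :: "nat \<Rightarrow> 'a list \<Rightarrow> 'a list" where
  "inflate m f = concat (map (replicate m) f)"

lemma vecs_0 [simp]: "vecs R 0 = {[]}"
  by (auto simp: vecs_def)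

lemma Cons_in_vecs_iff [simp]: "a # u \<in> vecs R (Suc N) \<longleftrightarrow> a \<in> carrier R \<and> u \<in> vecs R N"
  by (auto simp: vecs_def)

lemma vecs_Suc: "vecs R (Suc N) = (\<lambda>(a, u). a # u) ` (carrier R \<times> vecs R N)"
  by (auto simp: vecs_def length_Suc_conv)

lemma append_in_vecs: "u \<in> vecs R M \<Longrightarrow> v \<in> vecs R N \<Longrightarrow> u @ v \<in> vecs R (M + N)"
  by (auto simp: vecs_def)

lemma take_in_vecs: "u \<in> vecs R (M + N) \<Longrightarrow> take M u \<in> vecs R M"
  by (auto simp: vecs_def dest: in_set_takeD)

lemma drop_in_vecs: "u \<in> vecs R (M + N) \<Longrightarrow> drop M u \<in> vecs R N"
  by (auto simp: vecs_def dest: in_set_dropD)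

lemma permute_in_vecs: "\<pi> permutes {..<N} \<Longrightarrow> u \<in> vecs R N \<Longrightarrow> permute_list \<pi> u \<in> vecs R N"
  by (auto simp: vecs_def)

lemma length_inflate [simp]: "length (inflate m f) = m * length f"
  by (induction f) (auto simp: inflate_def)

lemma inflate_simps [simp]: "inflate m [] = []" "inflate m (a # f) = replicate m a @ inflate m f"
  by (auto simp: inflate_def)

lemma inflate_in_vecs: "f \<in> vecs R n \<Longrightarrow> inflate m f \<in> vecs R (m * n)"
  by (auto simp: vecs_def) (auto simp: inflate_def)

lemma map_inflate: "map h (inflate m f) = inflate m (map h f)"
  by (induction f) auto

lemma mset_inflate: "mset (inflate m f) = repeat_mset m (mset f)"
  by (induction f) (auto simp: repeat_mset.rep_eq multiset_eq_iff)

locale finite_field = field R for R (structure) +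
  assumes finite_carrier: "finite (carrier R)"
begin

abbreviation q :: nat where "q \<equiv> card (carrier R)"

lemma card_carrier_ge_2: "q \<ge> 2"
proof -
  have "card {\<zero>, \<one>} \<le> q" using finite_carrier by (intro card_mono) auto
  thus ?thesis by simp
qed

lemma finite_vecs: "finite (vecs R N)"
  using finite_lists_length_eq[OF finite_carrier, of N] by (simp add: vecs_def conj_commute)

lemma card_vecs: "card (vecs R N) = q ^ N"
  using card_lists_length_eq[OF finite_carrier, of N] by (simp add: vecs_def conj_commute)

lemma rsum_closed: "set u \<subseteq> carrier R \<Longrightarrow> rsum R u \<in> carrier R"
  by (induction u) auto

lemma rsum_remove1:
  "x \<in> set u \<Longrightarrow> set u \<subseteq> carrier R \<Longrightarrow> rsum R u = x \<oplus> rsum R (remove1 x u)"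
proof (induction u)
  case (Cons a u)
  have "set (remove1 x u) \<subseteq> carrier R" using Cons.prems by (auto dest: notin_set_remove1)
  hence "rsum R (remove1 x u) \<in> carrier R" by (rule rsum_closed)
  thus ?case using Cons by (auto simp: a_lcomm)
qed simp

lemma rsum_mset_cong:
  "mset u = mset v \<Longrightarrow> set u \<subseteq> carrier R \<Longrightarrow> rsum R u = rsum R v"
proof (induction u arbitrary: v)
  case (Cons a u)
  have "a \<in> set v" using Cons.prems by (metis list.set_intros(1) mset_eq_setD)
  moreover have "set v \<subseteq> carrier R" using Cons.prems by (metis mset_eq_setD)
  moreover have "rsum R u = rsum R (remove1 a v)"
    using Cons.prems by (intro Cons.IH) (auto simp flip: Cons.prems(1))
  ultimately show ?case by (simp add: rsum_remove1[of a v])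
qed simp

lemma dot_Nil [simp]: "dot R [] v = \<zero>"
  by (simp add: dot_def)

lemma dot_Cons [simp]: "dot R (a # u) (b # v) = a \<otimes> b \<oplus> dot R u v"
  by (simp add: dot_def)

lemma dot_closed: "set u \<subseteq> carrier R \<Longrightarrow> set v \<subseteq> carrier R \<Longrightarrow> dot R u v \<in> carrier R"
  unfolding dot_def by (intro rsum_closed) (auto dest: set_zip_leftD set_zip_rightD)

lemma dot_closed' [simp]: "u \<in> vecs R M \<Longrightarrow> v \<in> vecs R N \<Longrightarrow> dot R u v \<in> carrier R"
  by (auto simp: vecs_def intro: dot_closed)

lemma dot_append:
  assumes "length u = length v" "set u \<subseteq> carrier R" "set v \<subseteq> carrier R"
    and "set u' \<subseteq> carrier R" "set v' \<subseteq> carrier R"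
  shows "dot R (u @ u') (v @ v') = dot R u v \<oplus> dot R u' v'"
  using assms by (induction u v rule: list_induct2) (auto simp: dot_closed a_assoc)

lemma dot_zero: "set u \<subseteq> carrier R \<Longrightarrow> dot R u (replicate (length u) \<zero>) = \<zero>"
  by (induction u) auto

lemma dot_commute: "set u \<subseteq> carrier R \<Longrightarrow> set v \<subseteq> carrier R \<Longrightarrow> dot R u v = dot R v u"
  by (induction u v rule: list_induct2') (auto simp: m_comm dot_def)

lemma dot_add_right:
  assumes "length u = length v" "length v = length w"
    and "set u \<subseteq> carrier R" "set v \<subseteq> carrier R" "set w \<subseteq> carrier R"
  shows "dot R u (map2 (\<oplus>) v w) = dot R u v \<oplus> dot R u w"
  using assms
proof (induction u v w rule: list_induct3)
  case (Cons a u b v c w)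
  have "dot R u v \<in> carrier R" "dot R u w \<in> carrier R" using Cons.prems by (auto intro: dot_closed)
  thus ?case using Cons by (simp add: r_distr a_ac)
qed simp

lemma dot_replicate:
  "set u \<subseteq> carrier R \<Longrightarrow> a \<in> carrier R \<Longrightarrow> dot R u (replicate (length u) a) = rsum R u \<otimes> a"
  by (induction u) (auto simp: rsum_closed l_distr)

lemma dot_permute_list:
  assumes "\<pi> permutes {..<N}" "u \<in> vecs R N" "v \<in> vecs R N"
  shows "dot R (permute_list \<pi> u) (permute_list \<pi> v) = dot R u v"
proof -
  have len: "length u = N" "length v = N" using assms by (auto simp: vecs_def)
  have "map2 (\<otimes>) (permute_list \<pi> u) (permute_list \<pi> v) = permute_list \<pi> (map2 (\<otimes>) u v)"
    using assms len by (simp add: permute_list_map flip: permute_list_zip[where A = "{..<N}"])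
  moreover have "rsum R (permute_list \<pi> (map2 (\<otimes>) u v)) = rsum R (map2 (\<otimes>) u v)"
    using assms len
    by (intro rsum_mset_cong)
      (auto simp: vecs_def subset_iff dest: set_zip_leftD set_zip_rightD)
  ultimately show ?thesis by (simp add: dot_def)
qed

section \<open>Block sums, their transpose, and counting solutions of linear equations\<close>

lemma block_sums_in_vecs: "y \<in> vecs R (m * n) \<Longrightarrow> block_sums R m n y \<in> vecs R n"
proof (induction n arbitrary: y)
  case (Suc n)
  hence "y \<in> vecs R (m + m * n)" by simp
  hence "take m y \<in> vecs R m" "drop m y \<in> vecs R (m * n)"
    by (auto intro: take_in_vecs drop_in_vecs)
  thus ?case using Suc.IH by (auto simp: vecs_def intro: rsum_closed)
qed (simp add: vecs_def)

text \<open>The extension is constant on each block, so its label factors out of that block's part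
  of the bilinear form and leaves the block sum.\<close>

lemma dot_block_sums:
  "y \<in> vecs R (m * n) \<Longrightarrow> f \<in> vecs R n \<Longrightarrow> dot R (block_sums R m n y) f = dot R y (inflate m f)"
proof (induction n arbitrary: y f)
  case (Suc n)
  then obtain a g where f: "f = a # g" "a \<in> carrier R" "g \<in> vecs R n"
    by (auto simp: vecs_Suc)
  have "y \<in> vecs R (m + m * n)" using Suc.prems by simp
  hence y: "take m y \<in> vecs R m" "drop m y \<in> vecs R (m * n)"
    by (auto intro: take_in_vecs drop_in_vecs)
  have "dot R y (inflate m f) = dot R (take m y @ drop m y) (replicate m a @ inflate m g)"
    by (simp add: f)
  also have "\<dots> = dot R (take m y) (replicate m a) \<oplus> dot R (drop m y) (inflate m g)"
    using y f inflate_in_vecs[OF f(3), of m] by (intro dot_append) (auto simp: vecs_def)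
  also have "dot R (take m y) (replicate m a) = rsum R (take m y) \<otimes> a"
    using dot_replicate[of "take m y" a] y f by (simp add: vecs_def)
  finally show ?case using Suc.IH[OF y(2) f(3)] by (simp add: f)
qed simp

text \<open>A nonzero functional takes every value equally often. If the tail of \<open>v\<close>
  vanishes, its head is invertible and the first coordinate of \<open>u\<close> is forced while the
  rest is free; otherwise the first coordinate is fixed arbitrarily and induction handles the rest.
  Multiplying by \<open>q\<close> avoids the exponent \<open>N - 1\<close>.\<close>

lemma card_dot_eq:
  assumes "v \<in> vecs R N" "v \<noteq> replicate N \<zero>" "a \<in> carrier R"
  shows "q * card {u \<in> vecs R N. dot R u v = a} = q ^ N"
  using assms
proof (induction N arbitrary: v a)
  case (Suc N)
  then obtain b w where v: "v = b # w" "b \<in> carrier R" "w \<in> vecs R N"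
    by (auto simp: vecs_Suc)
  show ?case
  proof (cases "w = replicate N \<zero>")
    case True
    hence b: "b \<in> Units R" using v Suc.prems by (simp add: field_Units)
    have *: "dot R u w = \<zero>" if "u \<in> vecs R N" for u
      using that dot_zero[of u] True by (auto simp: vecs_def)
    have "{u \<in> vecs R (Suc N). dot R u v = a} = (\<lambda>u. (a \<otimes> inv b) # u) ` vecs R N"
    proof (intro equalityI subsetI)
      fix u assume "u \<in> {u \<in> vecs R (Suc N). dot R u v = a}"
      then obtain c u' where u: "u = c # u'" "c \<in> carrier R" "u' \<in> vecs R N" "c \<otimes> b = a"
        using v by (auto simp: vecs_Suc *)
      hence "a \<otimes> inv b = c" using b v by (auto simp: m_assoc)
      thus "u \<in> (\<lambda>u. (a \<otimes> inv b) # u) ` vecs R N" using u by auto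
    next
      fix u assume "u \<in> (\<lambda>u. (a \<otimes> inv b) # u) ` vecs R N"
      thus "u \<in> {u \<in> vecs R (Suc N). dot R u v = a}"
        using b v Suc.prems(3) by (auto simp: * m_assoc)
    qed
    hence "card {u \<in> vecs R (Suc N). dot R u v = a} = q ^ N"
      by (simp add: card_image inj_on_def card_vecs)
    thus ?thesis by simp
  next
    case False
    have "{u \<in> vecs R (Suc N). dot R u v = a} =
        (\<lambda>(c, u). c # u) ` (SIGMA c:carrier R. {u \<in> vecs R N. dot R u w = a \<ominus> c \<otimes> b})"
      (is "?L = ?f ` ?S")
    proof -
      have "c \<otimes> b \<oplus> dot R u w = a \<longleftrightarrow> dot R u w = a \<ominus> c \<otimes> b" if "c \<in> carrier R" "u \<in> vecs R N" for c u
      proof -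
        have "c \<otimes> b \<in> carrier R" "dot R u w \<in> carrier R" using that v by auto
        thus ?thesis using Suc.prems(3)
          by (metis a_comm a_minus_def add.inv_solve_right')
      qed
      hence "{c # u | c u. c \<in> carrier R \<and> u \<in> vecs R N \<and> c \<otimes> b \<oplus> dot R u w = a} = ?f ` ?S"
        by force
      moreover have "?L = {c # u | c u. c \<in> carrier R \<and> u \<in> vecs R N \<and> c \<otimes> b \<oplus> dot R u w = a}"
        using v by (auto simp: vecs_Suc)
      ultimately show ?thesis by simp
    qed
    also have "card (?f ` ?S) = card ?S" by (intro card_image) (auto simp: inj_on_def)
    also have "\<dots> = (\<Sum>c\<in>carrier R. card {u \<in> vecs R N. dot R u w = a \<ominus> c \<otimes> b})"
      using finite_carrier finite_vecs by (intro card_SigmaI) auto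
    finally have "q * card ?L = (\<Sum>c\<in>carrier R. q * card {u \<in> vecs R N. dot R u w = a \<ominus> c \<otimes> b})"
      by (simp add: sum_distrib_left)
    also have "\<dots> = (\<Sum>c\<in>carrier R. q ^ N)"
      using v False Suc.prems(3) by (intro sum.cong refl Suc.IH) auto
    finally show ?thesis by simp
  qed
qed simp

text \<open>Rank equality of a linear map and its transpose, obtained by counting the orthogonal pairs
  \<open>(y, w)\<close> in two ways.\<close>

lemma card_kernel_transpose:
  assumes \<phi>: "\<And>y. y \<in> vecs R M \<Longrightarrow> \<phi> y \<in> vecs R K"
    and \<psi>: "\<And>w. w \<in> vecs R K \<Longrightarrow> \<psi> w \<in> vecs R M"
    and adj: "\<And>y w. y \<in> vecs R M \<Longrightarrow> w \<in> vecs R K \<Longrightarrow> dot R (\<phi> y) w = dot R y (\<psi> w)"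
  shows "card {y \<in> vecs R M. \<phi> y = replicate K \<zero>} * q ^ K
           = card {w \<in> vecs R K. \<psi> w = replicate M \<zero>} * q ^ M"
proof -
  define Y0 where "Y0 = {y \<in> vecs R M. \<phi> y = replicate K \<zero>}"
  define W0 where "W0 = {w \<in> vecs R K. \<psi> w = replicate M \<zero>}"
  \<comment> \<open>By \<open>card_dot_eq\<close>, \<open>q\<close> times the number of
    \<open>w\<close> orthogonal to \<open>h y\<close> is \<open>q ^ N\<close> when
    \<open>h y\<close> is nonzero. When \<open>h y\<close> is zero all \<open>w\<close> qualify,
    which adds a surplus of \<open>(q - 1) * q ^ N\<close>.\<close>
  have count: "q * (\<Sum>y\<in>Y. card {w \<in> vecs R N. dot R w (h y) = \<zero>}) =
      (q - 1) * card {y \<in> Y. h y = replicate N \<zero>} * q ^ N + card Y * q ^ N"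
    if Y: "finite Y" "\<And>y. y \<in> Y \<Longrightarrow> h y \<in> vecs R N" for Y :: "'a list set" and h N
  proof -
    have "q * card {w \<in> vecs R N. dot R w (h y) = \<zero>} =
        (if h y = replicate N \<zero> then (q - 1) * q ^ N else 0) + q ^ N" if y: "y \<in> Y" for y
    proof (cases "h y = replicate N \<zero>")
      case True
      hence "{w \<in> vecs R N. dot R w (h y) = \<zero>} = vecs R N"
        using dot_zero by (auto simp: vecs_def)
      moreover have "q * q ^ N = (q - 1) * q ^ N + q ^ N"
        using card_carrier_ge_2 by (cases "card (carrier R)") auto
      ultimately show ?thesis using True by (simp only: card_vecs simp_thms if_True)
    next
      case False
      thus ?thesis using card_dot_eq[OF Y(2)[OF y] False] by simp
    qed
    hence "q * (\<Sum>y\<in>Y. card {w \<in> vecs R N. dot R w (h y) = \<zero>}) =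
        (\<Sum>y\<in>Y. (if h y = replicate N \<zero> then (q - 1) * q ^ N else 0) + q ^ N)"
      unfolding sum_distrib_left by (intro sum.cong) auto
    also have "\<dots> = (q - 1) * card {y \<in> Y. h y = replicate N \<zero>} * q ^ N + card Y * q ^ N"
      using Y(1) by (simp add: sum.distrib sum.If_cases Int_def)
    finally show ?thesis .
  qed
  have "(\<Sum>y\<in>vecs R M. card {w \<in> vecs R K. dot R w (\<phi> y) = \<zero>}) =
        (\<Sum>y\<in>vecs R M. card {w \<in> vecs R K. dot R y (\<psi> w) = \<zero>})"
    using \<phi> adj dot_commute
    by (intro sum.cong refl arg_cong[where f = card] Collect_cong) (auto simp: vecs_def subset_iff)
  also have "\<dots> = (\<Sum>w\<in>vecs R K. card {y \<in> vecs R M. dot R y (\<psi> w) = \<zero>})"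
    by (rule sum_multicount_gen[symmetric]) (auto simp: finite_vecs)
  finally have sums: "(\<Sum>y\<in>vecs R M. card {w \<in> vecs R K. dot R w (\<phi> y) = \<zero>}) =
      (\<Sum>w\<in>vecs R K. card {y \<in> vecs R M. dot R y (\<psi> w) = \<zero>})" .
  \<comment> \<open>The contributions \<open>q ^ M * q ^ K\<close> of all vectors agree on both
    sides and cancel, leaving only the surplus of the two kernels; then \<open>q - 1 > 0\<close> is
    divided out.\<close>
  have "(q - 1) * card Y0 * q ^ K + q ^ M * q ^ K = (q - 1) * card W0 * q ^ M + q ^ K * q ^ M"
    using arg_cong[OF sums, of "(*) q"] count[OF finite_vecs \<phi>, of M] count[OF finite_vecs \<psi>, of K]
    by (simp only: card_vecs Y0_def W0_def)
  hence "(q - 1) * (card Y0 * q ^ K) = (q - 1) * (card W0 * q ^ M)" by (simp add: algebra_simps)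
  thus ?thesis using card_carrier_ge_2 by (simp add: Y0_def W0_def)
qed

end

subsection \<open>Unshuffled outputs\<close>

text \<open>Seeing the share set as a level set of the all-ones functional makes
  \<open>card_dot_eq\<close> give its size.\<close>

lemma (in finite_field) shares_eq:
  "shares R m a = {u \<in> vecs R m. dot R u (replicate m \<one>) = a}"
  using dot_replicate[OF _ one_closed] by (auto simp: shares_def vecs_def rsum_closed)

lemma (in finite_field) card_shares:
  assumes "m > 0" "a \<in> carrier R"
  shows "q * card (shares R m a) = q ^ m"
  unfolding shares_eq using assms
  by (intro card_dot_eq) (auto simp: vecs_def replicate_eq_replicate)

text \<open>This is the set \<open>B\<close> of unshuffled outputs on input \<open>x\<close>,
  written as a fibre of a linear map.\<close>

definition block_fibre :: "('a, 'b) ring_scheme \<Rightarrow> nat \<Rightarrow> 'a list \<Rightarrow> 'a list set" where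
  "block_fibre R m x = {y \<in> vecs R (m * length x). block_sums R m (length x) y = x}"

lemma block_fibre_Nil [simp]: "block_fibre R m [] = {[]}"
  by (auto simp: block_fibre_def)

text \<open>Mirrors the recursion of \<open>split_all\<close>, so that sizes and uniformity follow
  by induction on the parties.\<close>

lemma block_fibre_Cons:
  "block_fibre R m (a # x) = (\<lambda>(ys, zs). ys @ zs) ` (shares R m a \<times> block_fibre R m x)"
proof (intro equalityI subsetI)
  fix y assume y: "y \<in> block_fibre R m (a # x)"
  hence "y \<in> vecs R (m + m * length x)" by (simp add: block_fibre_def)
  hence "take m y \<in> vecs R m" "drop m y \<in> vecs R (m * length x)"
    by (auto intro: take_in_vecs drop_in_vecs)
  hence "(take m y, drop m y) \<in> shares R m a \<times> block_fibre R m x"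
    using y by (auto simp: block_fibre_def shares_def vecs_def)
  thus "y \<in> (\<lambda>(ys, zs). ys @ zs) ` (shares R m a \<times> block_fibre R m x)"
    by (rule rev_image_eqI) simp
next
  fix y assume "y \<in> (\<lambda>(ys, zs). ys @ zs) ` (shares R m a \<times> block_fibre R m x)"
  thus "y \<in> block_fibre R m (a # x)"
    by (auto simp: block_fibre_def shares_def vecs_def)
qed

lemma inj_on_append_shares: "inj_on (\<lambda>(ys, zs). ys @ zs) (shares R m a \<times> Z)"
  by (auto simp: inj_on_def shares_def)

context finite_field
begin

lemma finite_shares: "finite (shares R m a)"
  by (simp add: shares_eq finite_vecs)

lemma finite_block_fibre: "finite (block_fibre R m x)"
  by (simp add: block_fibre_def finite_vecs)

lemma card_block_fibre:
  "m > 0 \<Longrightarrow> set x \<subseteq> carrier R \<Longrightarrow> q ^ length x * card (block_fibre R m x) = q ^ (m * length x)"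
proof (induction x)
  case (Cons a x)
  have "card (block_fibre R m (a # x)) = card (shares R m a) * card (block_fibre R m x)"
    by (simp only: block_fibre_Cons card_image[OF inj_on_append_shares] card_cartesian_product)
  hence "q ^ length (a # x) * card (block_fibre R m (a # x)) =
        (q * card (shares R m a)) * (q ^ length x * card (block_fibre R m x))"
    by simp
  also have "\<dots> = q ^ m * q ^ (m * length x)" using Cons card_shares[of m a] by simp
  finally show ?case by (simp add: power_add)
qed simp

lemma block_fibre_nonempty:
  assumes "m > 0" "set x \<subseteq> carrier R"
  shows "block_fibre R m x \<noteq> {}"
  using card_block_fibre[OF assms] card_carrier_ge_2 by (intro notI) auto

text \<open>Independent uniform choices are uniform on the product of their supports, and
  concatenation is injective on it because the first block has length \<open>m\<close>. The
  condition \<open>m > 0\<close> makes every share set nonempty.\<close>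

lemma split_all_eq:
  "m > 0 \<Longrightarrow> set x \<subseteq> carrier R \<Longrightarrow> split_all R m x = pmf_of_set (block_fibre R m x)"
proof (induction x)
  case (Cons a x)
  have ne: "shares R m a \<noteq> {}"
    using card_shares[of m a] Cons.prems card_carrier_ge_2 by (intro notI) auto
  have ne': "block_fibre R m x \<noteq> {}" using Cons.prems by (intro block_fibre_nonempty) auto
  have "pmf_of_set (block_fibre R m (a # x)) =
      map_pmf (\<lambda>(ys, zs). ys @ zs) (pmf_of_set (shares R m a \<times> block_fibre R m x))"
    unfolding block_fibre_Cons using ne ne'
    by (intro map_pmf_of_set_inj[symmetric] inj_on_append_shares)
      (auto simp: finite_shares finite_block_fibre)
  also have "pmf_of_set (shares R m a \<times> block_fibre R m x) =
      pair_pmf (pmf_of_set (shares R m a)) (pmf_of_set (block_fibre R m x))"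
    using ne ne'
    by (intro pmf_eqI)
      (auto simp: pmf_pair finite_shares finite_block_fibre card_cartesian_product indicator_def
        pmf_of_set[OF ne finite_shares] pmf_of_set[OF ne' finite_block_fibre])
  finally show ?case using Cons
    by (simp add: split_pmf_def pair_pmf_def map_bind_pmf map_pmf_def bind_assoc_pmf bind_return_pmf)
qed (simp add: pmf_of_set_singleton)

section \<open>Collisions under a fixed permutation as a fibre of a linear map\<close>

lemma rsum_map2_minus:
  "length u = length v \<Longrightarrow> set u \<subseteq> carrier R \<Longrightarrow> set v \<subseteq> carrier R
     \<Longrightarrow> rsum R (map2 (a_minus R) u v) = rsum R u \<ominus> rsum R v"
proof (induction u v rule: list_induct2)
  case (Cons a u b v)
  have "rsum R u \<in> carrier R" "rsum R v \<in> carrier R" using Cons.prems by (auto intro: rsum_closed)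
  thus ?case using Cons by (simp add: a_minus_def minus_add a_ac)
qed (simp add: a_minus_def)

lemma map2_minus_in_vecs: "u \<in> vecs R N \<Longrightarrow> v \<in> vecs R N \<Longrightarrow> map2 (a_minus R) u v \<in> vecs R N"
  by (auto simp: vecs_def subset_iff dest: set_zip_leftD set_zip_rightD)

lemma map2_minus_self: "u \<in> vecs R N \<Longrightarrow> map2 (a_minus R) u u = replicate N \<zero>"
  by (auto simp: vecs_def list_eq_iff_nth_eq subset_iff a_minus_def r_neg)

lemma block_sums_map2_minus:
  "u \<in> vecs R (m * n) \<Longrightarrow> v \<in> vecs R (m * n)
     \<Longrightarrow> block_sums R m n (map2 (a_minus R) u v) = map2 (a_minus R) (block_sums R m n u) (block_sums R m n v)"
proof (induction n arbitrary: u v)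
  case (Suc n)
  have uv: "u \<in> vecs R (m + m * n)" "v \<in> vecs R (m + m * n)" using Suc.prems by simp_all
  note * = this[THEN take_in_vecs] this[THEN drop_in_vecs]
  have "rsum R (map2 (a_minus R) (take m u) (take m v)) = rsum R (take m u) \<ominus> rsum R (take m v)"
    using * by (intro rsum_map2_minus) (auto simp: vecs_def)
  thus ?case using Suc.IH[OF *(3,4)] by (simp add: take_map drop_map take_zip drop_zip)
qed simp

lemma permute_list_map2_minus:
  assumes "\<pi> permutes {..<N}" "u \<in> vecs R N" "v \<in> vecs R N"
  shows "permute_list \<pi> (map2 (a_minus R) u v) = map2 (a_minus R) (permute_list \<pi> u) (permute_list \<pi> v)"
  using assms
  by (simp add: vecs_def permute_list_map flip: permute_list_zip[where A = "{..<N}"])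

text \<open>Sign changes turn the kernel of the transpose into the pairs \<open>(f, g)\<close> of labellings
  of the blocks that agree along \<open>\<pi>\<close>.\<close>

lemma card_block_fibre_permute_le:
  assumes m: "m > 0" and x: "set x \<subseteq> carrier R" and M: "M = m * length x"
    and \<pi>: "\<pi> permutes {..<M}"
  shows "card {y \<in> block_fibre R m x. permute_list \<pi> y \<in> block_fibre R m x} * q ^ (2 * length x)
     \<le> card {(f, g). f \<in> vecs R (length x) \<and> g \<in> vecs R (length x)
           \<and> permute_list \<pi> (inflate m f) = inflate m g} * q ^ M"
proof -
  define n where "n = length x"
  \<comment> \<open>The collisions \<open>y\<close> are exactly the fibre of \<open>\<phi>\<close>
    over \<open>x @ x\<close>. The map \<open>\<psi>\<close> is the transpose of
    \<open>\<phi>\<close>, where \<open>\<rho>\<close> undoes \<open>\<pi>\<close>.\<close>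
  define \<phi> where "\<phi> y = block_sums R m n y @ block_sums R m n (permute_list \<pi> y)" for y
  define \<rho> where "\<rho> = inv_into UNIV \<pi>"
  define \<psi> where "\<psi> w = map2 (\<oplus>) (inflate m (take n w)) (permute_list \<rho> (inflate m (drop n w)))" for w
  have M': "M = m * n" by (simp add: M n_def)
  have \<rho>: "\<rho> permutes {..<M}" unfolding \<rho>_def by (rule permutes_inv[OF \<pi>])
  have \<pi>\<rho>: "permute_list \<pi> (permute_list \<rho> u) = u" if "length u = M" for u :: "'a list"
    using permutes_inv_o(2)[OF \<pi>] \<pi> that
    by (simp add: \<rho>_def flip: permute_list_compose)
  have \<phi>_vecs: "\<phi> y \<in> vecs R (2 * n)" if "y \<in> vecs R M" for y
    using append_in_vecs[OF block_sums_in_vecs block_sums_in_vecs] that permute_in_vecs[OF \<pi> that]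
    unfolding \<phi>_def M' mult_2 by blast
  have parts: "inflate m (take n w) \<in> vecs R M" "permute_list \<rho> (inflate m (drop n w)) \<in> vecs R M"
    if "w \<in> vecs R (2 * n)" for w
    using that take_in_vecs[of w R n n] drop_in_vecs[of w R n n] permute_in_vecs[OF \<rho>]
    unfolding M' by (auto simp: mult_2 intro!: inflate_in_vecs)
  have \<psi>_vecs: "\<psi> w \<in> vecs R M" if "w \<in> vecs R (2 * n)" for w
    using parts[OF that] unfolding \<psi>_def
    by (auto simp: vecs_def subset_iff dest: set_zip_leftD set_zip_rightD)
  have adj: "dot R (\<phi> y) w = dot R y (\<psi> w)" if y: "y \<in> vecs R M" and w: "w \<in> vecs R (2 * n)" for y w
  proof -
    have w12: "take n w \<in> vecs R n" "drop n w \<in> vecs R n"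
      using w take_in_vecs[of w R n n] drop_in_vecs[of w R n n] by (auto simp: mult_2)
    have y2: "permute_list \<pi> y \<in> vecs R M" by (rule permute_in_vecs[OF \<pi> y])
    have "dot R (\<phi> y) w = dot R (\<phi> y) (take n w @ drop n w)" by simp
    also have "\<dots> = dot R (block_sums R m n y) (take n w)
        \<oplus> dot R (block_sums R m n (permute_list \<pi> y)) (drop n w)"
      unfolding \<phi>_def using w12 block_sums_in_vecs[of y m n] block_sums_in_vecs[of "permute_list \<pi> y" m n] y y2
      by (intro dot_append) (auto simp: vecs_def M')
    also have "\<dots> = dot R y (inflate m (take n w)) \<oplus> dot R (permute_list \<pi> y) (inflate m (drop n w))"
      using w12 y y2 by (simp add: dot_block_sums M')
    \<comment> \<open>Inserting \<open>\<pi>\<close> after \<open>\<rho>\<close> puts the same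
      permutation on both arguments, where \<open>dot\<close> does not see it.\<close>
    also have "dot R (permute_list \<pi> y) (inflate m (drop n w)) =
        dot R (permute_list \<pi> y) (permute_list \<pi> (permute_list \<rho> (inflate m (drop n w))))"
      using w12 by (subst \<pi>\<rho>) (auto simp: vecs_def M')
    also have "\<dots> = dot R y (permute_list \<rho> (inflate m (drop n w)))"
      by (rule dot_permute_list[OF \<pi> y parts(2)[OF w]])
    finally show ?thesis unfolding \<psi>_def using parts[OF w] y
      by (subst dot_add_right) (auto simp: vecs_def)
  qed
  let ?E = "{y \<in> block_fibre R m x. permute_list \<pi> y \<in> block_fibre R m x}"
  let ?K = "{y \<in> vecs R M. \<phi> y = replicate (2 * n) \<zero>}"
  let ?W = "{w \<in> vecs R (2 * n). \<psi> w = replicate M \<zero>}"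
  let ?P = "{(f, g). f \<in> vecs R n \<and> g \<in> vecs R n \<and> permute_list \<pi> (inflate m f) = inflate m g}"
  \<comment> \<open>A nonempty fibre of a linear map is a translate of the kernel: subtracting one
    element \<open>y0\<close> embeds it there.\<close>
  have "card ?E \<le> card ?K"
  proof (cases "?E = {}")
    case False
    then obtain y0 where y0: "y0 \<in> ?E" by blast
    hence y0v: "y0 \<in> vecs R M" by (auto simp: block_fibre_def M)
    have "(\<lambda>y. map2 (a_minus R) y y0) ` ?E \<subseteq> ?K"
    proof
      fix z assume "z \<in> (\<lambda>y. map2 (a_minus R) y y0) ` ?E"
      then obtain y where y: "y \<in> ?E" "z = map2 (a_minus R) y y0" by blast
      have yv: "y \<in> vecs R M" using y by (auto simp: block_fibre_def M)
      have "x \<in> vecs R n" using x by (simp add: vecs_def n_def)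
      hence "map2 (a_minus R) x x @ map2 (a_minus R) x x = replicate (2 * n) \<zero>"
        by (simp add: map2_minus_self mult_2 replicate_add)
      moreover have "block_sums R m n z = map2 (a_minus R) x x"
        using y y0 block_sums_map2_minus[of y m n y0] by (simp add: block_fibre_def n_def)
      moreover have "block_sums R m n (permute_list \<pi> z) = map2 (a_minus R) x x"
        using y y0 block_sums_map2_minus[of "permute_list \<pi> y" m n "permute_list \<pi> y0"]
        by (simp add: permute_list_map2_minus[OF \<pi> yv y0v] block_fibre_def n_def)
      ultimately show "z \<in> ?K"
        using map2_minus_in_vecs[OF yv y0v] y(2) by (simp add: \<phi>_def)
    qed
    moreover have "inj_on (\<lambda>y. map2 (a_minus R) y y0) ?E"
    proof (rule inj_onI)
      fix y z assume yz: "y \<in> ?E" "z \<in> ?E" and eq: "map2 (a_minus R) y y0 = map2 (a_minus R) z y0"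
      have v: "y \<in> vecs R M" "z \<in> vecs R M" using yz by (auto simp: block_fibre_def M)
      show "y = z"
      proof (rule nth_equalityI)
        fix i assume "i < length y"
        hence i: "i < M" using v by (simp add: vecs_def)
        have c: "y ! i \<in> carrier R" "z ! i \<in> carrier R" "y0 ! i \<in> carrier R"
          using v y0v i by (auto simp: vecs_def subset_iff)
        have "map2 (a_minus R) y y0 ! i = map2 (a_minus R) z y0 ! i" using eq by simp
        hence "y ! i \<ominus> y0 ! i = z ! i \<ominus> y0 ! i" using v y0v i by (simp add: vecs_def)
        thus "y ! i = z ! i" using c by (simp add: a_minus_def)
      qed (use v in \<open>simp add: vecs_def\<close>)
    qed
    ultimately show ?thesis
      by (intro card_inj_on_le[where f = "\<lambda>y. map2 (a_minus R) y y0"]) (auto simp: finite_vecs)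
  next
    case True
    show ?thesis unfolding True by simp
  qed
  hence "card ?E * q ^ (2 * n) \<le> card ?K * q ^ (2 * n)" by simp
  also have "\<dots> = card ?W * q ^ M"
    by (intro card_kernel_transpose \<phi>_vecs \<psi>_vecs adj)
  finally have "card ?E * q ^ (2 * n) \<le> card ?W * q ^ M" .
  moreover have "card ?W \<le> card ?P"
  proof (rule card_inj_on_le[where f = "\<lambda>w. (take n w, map (\<lambda>a. \<ominus> a) (drop n w))"])
    show "inj_on (\<lambda>w. (take n w, map (\<lambda>a. \<ominus> a) (drop n w))) ?W"
    proof (rule inj_onI)
      fix v w assume vw: "v \<in> ?W" "w \<in> ?W"
        and eq: "(take n v, map (\<lambda>a. \<ominus> a) (drop n v)) = (take n w, map (\<lambda>a. \<ominus> a) (drop n w))"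
      have "inj_on (\<lambda>a. \<ominus> a) (carrier R)" by (rule inj_on_inverseI[where g = "\<lambda>a. \<ominus> a"]) simp
      moreover have "set (drop n v) \<union> set (drop n w) \<subseteq> carrier R"
        using vw by (auto simp: vecs_def dest: in_set_dropD)
      ultimately have "inj_on (\<lambda>a. \<ominus> a) (set (drop n v) \<union> set (drop n w))"
        by (rule inj_on_subset)
      hence "drop n v = drop n w" using eq by (auto dest: map_inj_on)
      thus "v = w" using eq by (metis append_take_drop_id prod.inject)
    qed
    show "(\<lambda>w. (take n w, map (\<lambda>a. \<ominus> a) (drop n w))) ` ?W \<subseteq> ?P"
    proof clarify
      fix w assume w: "w \<in> vecs R (2 * n)" and 0: "\<psi> w = replicate M \<zero>"
      let ?a = "inflate m (take n w)" and ?b = "permute_list \<rho> (inflate m (drop n w))"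
      have w12: "take n w \<in> vecs R n" "drop n w \<in> vecs R n"
        using w take_in_vecs[of w R n n] drop_in_vecs[of w R n n] by (auto simp: mult_2)
      have ab: "?a \<in> vecs R M" "?b \<in> vecs R M" using parts[OF w] .
      have "?a = map (\<lambda>a. \<ominus> a) ?b"
      proof (rule nth_equalityI)
        fix i assume "i < length ?a"
        hence i: "i < M" using ab by (simp add: vecs_def)
        have c: "?a ! i \<in> carrier R" "?b ! i \<in> carrier R"
          using ab i by (auto simp: vecs_def subset_iff simp del: length_inflate length_permute_list)
        have "\<psi> w ! i = \<zero>" using 0 i by simp
        hence "?a ! i \<oplus> ?b ! i = \<zero>" unfolding \<psi>_def using ab i by (simp add: vecs_def)
        hence "?a ! i = \<ominus> (?b ! i)" using c by (simp add: minus_equality[symmetric] a_comm)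
        thus "?a ! i = map (\<lambda>a. \<ominus> a) ?b ! i" using ab i by (simp add: vecs_def)
      qed (use ab in \<open>simp add: vecs_def\<close>)
      hence "permute_list \<pi> ?a = map (\<lambda>a. \<ominus> a) (permute_list \<pi> ?b)"
        using \<pi> ab by (simp add: permute_list_map vecs_def)
      also have "permute_list \<pi> ?b = inflate m (drop n w)"
        using w12 by (intro \<pi>\<rho>) (simp add: vecs_def M')
      finally show "take n w \<in> vecs R n \<and> map (\<lambda>a. \<ominus> a) (drop n w) \<in> vecs R n \<and>
          permute_list \<pi> ?a = inflate m (map (\<lambda>a. \<ominus> a) (drop n w))"
        using w12 by (auto simp: map_inflate vecs_def)
    qed
    show "finite ?P"
      by (rule finite_subset[of _ "vecs R n \<times> vecs R n"]) (auto simp: finite_vecs)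
  qed
  ultimately have "card ?E * q ^ (2 * n) \<le> card ?P * q ^ M"
    by (meson le_trans mult_le_mono1)
  thus ?thesis by (simp only: n_def)
qed

end

subsection \<open>Averaging over the shuffle\<close>

text \<open>A multiset is encoded by a chosen enumeration of its support together with the
  multiplicities in that order: \<open>s\<close> labels from \<open>S\<close> and \<open>s\<close>
  numbers between 1 and \<open>n\<close>.\<close>

lemma card_multisets_of_support_size_le:
  fixes S :: "'a set"
  assumes "finite S"
  shows "card {A. size A = n \<and> set_mset A \<subseteq> S \<and> card (set_mset A) = s} \<le> (card S * n) ^ s"
proof -
  define as where "as A = (SOME xs. set xs = set_mset A \<and> distinct xs)" for A :: "'a multiset"
  have as: "set (as A) = set_mset A" "distinct (as A)" for A
  proof -
    have "\<exists>xs. set xs = set_mset A \<and> distinct xs" by (rule finite_distinct_list) simp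
    from someI_ex[OF this] show "set (as A) = set_mset A" "distinct (as A)" by (auto simp: as_def)
  qed
  let ?M = "{A. size A = n \<and> set_mset A \<subseteq> S \<and> card (set_mset A) = s}"
  let ?L = "\<lambda>X. {xs. set xs \<subseteq> X \<and> length xs = s}"
  have fin: "finite (?L S \<times> ?L {1..n})"
    using assms by (intro finite_cartesian_product finite_lists_length_eq) auto
  have "card ?M \<le> card (?L S \<times> ?L {1..n})"
  proof (rule card_inj_on_le[OF _ _ fin])
    show "inj_on (\<lambda>A. (as A, map (count A) (as A))) ?M"
    proof (rule inj_onI)
      fix A B assume eq: "(as A, map (count A) (as A)) = (as B, map (count B) (as B))"
      hence "set_mset A = set_mset B" using as(1) by (metis prod.inject)
      moreover have "count A x = count B x" if "x \<in># A" for x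
        using eq that as(1)[of A] by (auto simp flip: as(1)[of A])
      ultimately show "A = B" by (intro multiset_eqI) (metis count_inI)
    qed
    show "(\<lambda>A. (as A, map (count A) (as A))) ` ?M \<subseteq> ?L S \<times> ?L {1..n}"
    proof (intro image_subsetI SigmaI CollectI conjI)
      fix A assume A: "A \<in> ?M"
      show "set (as A) \<subseteq> S" using A as(1) by auto
      show len: "length (as A) = s" using A as(1,2)[of A] distinct_card[of "as A"] by simp
      show "length (map (count A) (as A)) = s" using len by simp
      show "set (map (count A) (as A)) \<subseteq> {1..n}"
        using A as(1)[of A] by (auto simp: count_le_size Suc_le_eq)
    qed
  qed
  also have "\<dots> = (card S * n) ^ s"
    using assms by (simp add: card_cartesian_product card_lists_length_eq power_mult_distrib)
  finally show ?thesis .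
qed

text \<open>A constant multiset of known size is determined by its label. The general bound would
  lose a factor \<open>n\<close>, and this level is the main term, where no loss is
  affordable.\<close>

lemma card_multisets_of_singleton_support_le:
  assumes "finite S"
  shows "card {A. size A = n \<and> set_mset A \<subseteq> S \<and> card (set_mset A) = 1} \<le> card S"
proof -
  have "{A. size A = n \<and> set_mset A \<subseteq> S \<and> card (set_mset A) = 1} \<subseteq> replicate_mset n ` S"
  proof
    fix A assume A: "A \<in> {A. size A = n \<and> set_mset A \<subseteq> S \<and> card (set_mset A) = 1}"
    then obtain a where a: "set_mset A = {a}" by (auto simp: card_1_singleton_iff)
    hence "A = replicate_mset (size A) a" by (metis set_mset_subset_singletonD subset_refl)
    thus "A \<in> replicate_mset n ` S" using A a by auto
  qed
  thus ?thesis
    by (rule le_trans[OF card_mono[OF finite_imageI[OF assms]] card_image_le[OF assms]])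
qed

lemma finite_multisets_of_size:
  "finite S \<Longrightarrow> finite {A. size A = n \<and> set_mset A \<subseteq> S}"
proof -
  assume "finite S"
  have "{A. size A = n \<and> set_mset A \<subseteq> S} \<subseteq> mset ` {xs. set xs \<subseteq> S \<and> length xs = n}"
  proof
    fix A assume "A \<in> {A. size A = n \<and> set_mset A \<subseteq> S}"
    moreover obtain xs where "mset xs = A" using ex_mset by blast
    ultimately show "A \<in> mset ` {xs. set xs \<subseteq> S \<and> length xs = n}" by auto
  qed
  thus ?thesis
    by (rule finite_subset[OF _ finite_imageI[OF finite_lists_length_eq[OF \<open>finite S\<close>]]])
qed

text \<open>The multisets are grouped by the number \<open>s\<close> of distinct labels. Level
  \<open>s\<close> contributes at most \<open>card S * r ^ (s - 1)\<close>, and the geometric series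
  is summed.\<close>

lemma sum_inverse_card_permutations_le:
  fixes S :: "'a set"
  assumes S: "finite S" and n: "n > 0" and k: "2 * k \<le> j"
    and r: "r = real (card S) * real n ^ 2 / real n ^ k" "r \<le> 1 / 2"
  shows "(\<Sum>A | size A = n \<and> set_mset A \<subseteq> S. 1 / real (card (permutations_of_multiset A)) ^ j)
           \<le> real (card S) * (1 + 2 * r)"
proof -
  define q where "q = card S"
  let ?M = "{A. size A = n \<and> set_mset A \<subseteq> S}"
  let ?N = "\<lambda>A :: 'a multiset. card (permutations_of_multiset A)"
  let ?Ms = "\<lambda>s. {A. size A = n \<and> set_mset A \<subseteq> S \<and> card (set_mset A) = s}"
  have finM: "finite ?M" by (rule finite_multisets_of_size[OF S])
  have r0: "r \<ge> 0" by (simp add: r(1))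
  \<comment> \<open>This is the \<open>k\<close>-th power of
    \<open>card_permutations_of_multiset_square_ge\<close>; \<open>2 * k \<le> j\<close> allows
    passing to the exponent \<open>j\<close>.\<close>
  have term_le: "1 / real (?N A) ^ j \<le> 1 / real n ^ (k * (card (set_mset A) - 1))" if A: "A \<in> ?M" for A
  proof -
    have "A \<noteq> {#}" using A n by auto
    have N1: "?N A \<ge> 1"
      by (simp add: Suc_le_eq card_gt_0_iff)
    have "n ^ (k * (card (set_mset A) - 1)) = (size A ^ (card (set_mset A) - 1)) ^ k"
      using A by (simp add: mult.commute flip: power_mult)
    also have "\<dots> \<le> (?N A ^ 2) ^ k"
      using card_permutations_of_multiset_square_ge[OF \<open>A \<noteq> {#}\<close>] by (intro power_mono) auto
    also have "\<dots> \<le> ?N A ^ j"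
      using k N1 by (simp flip: power_mult add: power_increasing)
    finally have "real n ^ (k * (card (set_mset A) - 1)) \<le> real (?N A) ^ j"
      by (metis of_nat_le_iff of_nat_power)
    thus ?thesis using n N1 by (intro divide_left_mono mult_pos_pos zero_less_power) auto
  qed
  have level: "real (card (?Ms s)) / real n ^ (k * (s - 1)) \<le> q * r ^ (s - 1)" if "s \<ge> 1" for s
  proof (cases "s = 1")
    case True
    thus ?thesis using card_multisets_of_singleton_support_le[OF S, of n] by (simp add: q_def)
  next
    case False
    then obtain t where t: "s = Suc (Suc t)" using \<open>s \<ge> 1\<close> by (metis One_nat_def Suc_le_D not0_implies_Suc)
    have "real (card (?Ms s)) \<le> (q * n) ^ s"
      using card_multisets_of_support_size_le[OF S, of n s] by (simp only: q_def of_nat_le_iff)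
    also have "\<dots> = q ^ s * n ^ s" by (simp add: power_mult_distrib)
    \<comment> \<open>As \<open>s \<ge> 2\<close>, the exponent \<open>s\<close> is at most
      \<open>2 * (s - 1)\<close>. This is the origin of the square of \<open>n\<close> in
      \<open>r\<close>, and it makes the bound a power of \<open>r\<close>.\<close>
    also have "\<dots> \<le> q ^ s * n ^ (2 * (s - 1))"
      using n t by (intro of_nat_mono mult_left_mono power_increasing) auto
    finally have "real (card (?Ms s)) \<le> q ^ s * n ^ (2 * (s - 1))" .
    hence "real (card (?Ms s)) / real n ^ (k * (s - 1))
        \<le> (q ^ s * n ^ (2 * (s - 1))) / real n ^ (k * (s - 1))"
      by (intro divide_right_mono) auto
    also have "\<dots> = q * r ^ (s - 1)"
      unfolding r(1) t q_def power_divide power_mult_distrib power_mult by (simp add: power_mult)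
    finally show ?thesis .
  qed
  have "(\<Sum>A\<in>?M. 1 / real (?N A) ^ j) \<le> (\<Sum>A\<in>?M. 1 / real n ^ (k * (card (set_mset A) - 1)))"
    by (intro sum_mono term_le)
  also have "\<dots> = (\<Sum>s\<in>{1..q}. \<Sum>A | A \<in> ?M \<and> card (set_mset A) = s. 1 / real n ^ (k * (card (set_mset A) - 1)))"
  proof (rule sum.group[symmetric])
    show "(\<lambda>A. card (set_mset A)) ` ?M \<subseteq> {1..q}"
      using n S by (auto simp: q_def Suc_le_eq card_gt_0_iff intro: card_mono)
  qed (use finM in auto)
  also have "\<dots> = (\<Sum>s\<in>{1..q}. real (card (?Ms s)) / real n ^ (k * (s - 1)))"
    by (intro sum.cong refl) (simp add: conj_assoc)
  also have "\<dots> \<le> (\<Sum>s\<in>{1..q}. q * r ^ (s - 1))"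
    by (intro sum_mono level) auto
  also have "\<dots> = q * (\<Sum>t<q. r ^ t)"
    unfolding sum_distrib_left
    by (rule sum.reindex_bij_witness[of _ Suc "\<lambda>s. s - 1"]) auto
  also have "(\<Sum>t<q. r ^ t) \<le> 1 / (1 - r)"
    using r0 r(2) sum_le_suminf[of "\<lambda>t. r ^ t" "{..<q}"] suminf_geometric[of r]
    by (simp add: summable_geometric)
  also have "1 / (1 - r) \<le> 1 + 2 * r"
  proof -
    have "0 \<le> r * (1 - 2 * r)" using r0 r(2) by (intro mult_nonneg_nonneg) auto
    thus ?thesis using r(2) by (simp add: field_simps)
  qed
  finally show ?thesis by (simp add: q_def mult_left_mono)
qed

section \<open>Summing agreeing pairs of labellings over all permutations\<close>

context finite_field
begin

text \<open>The sums over \<open>\<pi>\<close> and over \<open>(f, g)\<close> are exchanged, and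
  \<open>card_permutations_permuting_to\<close> counts the \<open>\<pi>\<close> for each pair with a
  common multiset. For given \<open>f\<close>, the admissible \<open>g\<close> are the arrangements
  of \<open>mset f\<close>.\<close>

lemma sum_card_agreeing_labellings_le:
  assumes m: "m \<ge> 2" and M: "M = m * n"
  shows "(\<Sum>\<pi> | \<pi> permutes {..<M}. real (card {(f, g). f \<in> vecs R n \<and> g \<in> vecs R n
              \<and> permute_list \<pi> (inflate m f) = inflate m g}))
     \<le> fact M * (\<Sum>A | size A = n \<and> set_mset A \<subseteq> carrier R.
                   1 / real (card (permutations_of_multiset A)) ^ (m - 2))"
proof -
  let ?V = "vecs R n" and ?Pi = "{\<pi>. \<pi> permutes {..<M}}"
  let ?N = "\<lambda>A :: 'a multiset. card (permutations_of_multiset A)"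
  let ?Ms = "{A. size A = n \<and> set_mset A \<subseteq> carrier R}"
  have Npos: "real (?N A) > 0" for A by (simp add: card_gt_0_iff)
  have finPi: "finite ?Pi" by (simp add: finite_permutations)
  have perms_eq: "permutations_of_multiset (mset f) = {g \<in> ?V. mset g = mset f}" if "f \<in> ?V" for f
    using that by (auto simp: permutations_of_multiset_def vecs_def dest: mset_eq_length mset_eq_setD)
  have inner: "real (card {\<pi> \<in> ?Pi. permute_list \<pi> (inflate m f) = inflate m g}) =
      (if mset g = mset f then fact M / real (?N (repeat_mset m (mset f))) else 0)"
    if f: "f \<in> ?V" and g: "g \<in> ?V" for f g
  proof (cases "mset g = mset f")
    case True
    have "{\<pi> \<in> ?Pi. permute_list \<pi> (inflate m f) = inflate m g} =
        {\<pi>. \<pi> permutes {..<length (inflate m f)} \<and> permute_list \<pi> (inflate m f) = inflate m g}"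
      using f by (auto simp: vecs_def M)
    moreover have "card \<dots> * ?N (mset (inflate m f)) = fact (length (inflate m f))"
      using True by (intro card_permutations_permuting_to) (simp add: mset_inflate)
    ultimately have "card {\<pi> \<in> ?Pi. permute_list \<pi> (inflate m f) = inflate m g}
        * ?N (repeat_mset m (mset f)) = fact M"
      using f by (simp add: mset_inflate vecs_def M)
    from arg_cong[OF this, of real]
    have "real (card {\<pi> \<in> ?Pi. permute_list \<pi> (inflate m f) = inflate m g})
        * real (?N (repeat_mset m (mset f))) = fact M"
      by (simp only: of_nat_mult of_nat_fact)
    thus ?thesis using True Npos[of "repeat_mset m (mset f)"] by (simp add: field_simps)
  next
    case False
    \<comment> \<open>A permutation preserves the multiset of entries, and since \<open>m\<close> is
      nonzero the labels are determined by their \<open>m\<close>-fold repetition.\<close>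
    have "permute_list \<pi> (inflate m f) \<noteq> inflate m g" if "\<pi> \<in> ?Pi" for \<pi>
    proof
      assume "permute_list \<pi> (inflate m f) = inflate m g"
      moreover have "mset (permute_list \<pi> (inflate m f)) = mset (inflate m f)"
        using that f by (intro mset_permute_list) (simp add: vecs_def M)
      ultimately have "repeat_mset m (mset f) = repeat_mset m (mset g)" by (simp add: mset_inflate)
      thus False using False m by (auto simp: multiset_eq_iff)
    qed
    hence "{\<pi> \<in> ?Pi. permute_list \<pi> (inflate m f) = inflate m g} = {}" by blast
    thus ?thesis using False by (simp only: card.empty if_False of_nat_0)
  qed
  have "(\<Sum>\<pi>\<in>?Pi. card {(f, g). f \<in> ?V \<and> g \<in> ?V \<and> permute_list \<pi> (inflate m f) = inflate m g})
     = (\<Sum>\<pi>\<in>?Pi. card {w \<in> ?V \<times> ?V. permute_list \<pi> (inflate m (fst w)) = inflate m (snd w)})"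
    by (intro sum.cong refl arg_cong[where f = card]) auto
  also have "\<dots> = (\<Sum>w\<in>?V \<times> ?V. card {\<pi> \<in> ?Pi. permute_list \<pi> (inflate m (fst w)) = inflate m (snd w)})"
    by (rule sum_multicount_gen) (auto simp: finite_vecs finPi)
  finally have "(\<Sum>\<pi>\<in>?Pi. real (card {(f, g). f \<in> ?V \<and> g \<in> ?V \<and> permute_list \<pi> (inflate m f) = inflate m g}))
     = (\<Sum>w\<in>?V \<times> ?V. real (card {\<pi> \<in> ?Pi. permute_list \<pi> (inflate m (fst w)) = inflate m (snd w)}))"
    by (simp only: flip: of_nat_sum)
  also have "\<dots> = (\<Sum>f\<in>?V. \<Sum>g\<in>?V. real (card {\<pi> \<in> ?Pi. permute_list \<pi> (inflate m f) = inflate m g}))"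
    by (simp add: sum.cartesian_product case_prod_unfold)
  also have "\<dots> = (\<Sum>f\<in>?V. \<Sum>g\<in>?V. if mset g = mset f then fact M / real (?N (repeat_mset m (mset f))) else 0)"
    by (intro sum.cong refl inner)
  also have "\<dots> = (\<Sum>f\<in>?V. real (?N (mset f)) * (fact M / real (?N (repeat_mset m (mset f)))))"
  proof (rule sum.cong[OF refl])
    fix f assume f: "f \<in> ?V"
    have "?V \<inter> {g. mset g = mset f} = permutations_of_multiset (mset f)"
      using perms_eq[OF f] by auto
    thus "(\<Sum>g\<in>?V. if mset g = mset f then fact M / real (?N (repeat_mset m (mset f))) else 0) =
        real (?N (mset f)) * (fact M / real (?N (repeat_mset m (mset f))))"
      by (simp add: sum.If_cases finite_vecs)
  qed
  also have "\<dots> \<le> (\<Sum>f\<in>?V. fact M * (1 / real (?N (mset f)) ^ (m - 1)))"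
  proof (rule sum_mono)
    fix f
    let ?n = "real (?N (mset f))"
    have "?n ^ m \<le> real (?N (repeat_mset m (mset f)))"
      using card_permutations_of_multiset_repeat_ge[of "mset f" m] by (metis of_nat_le_iff of_nat_power)
    hence "?n * (fact M / real (?N (repeat_mset m (mset f)))) \<le> ?n * (fact M / ?n ^ m)"
      using Npos by (intro mult_left_mono divide_left_mono) auto
    also have "?n ^ m = ?n * ?n ^ (m - 1)" using m by (cases m) auto
    also have "?n * (fact M / (?n * ?n ^ (m - 1))) = fact M * (1 / ?n ^ (m - 1))"
      using Npos[of "mset f"] by simp
    finally show "?n * (fact M / real (?N (repeat_mset m (mset f)))) \<le> fact M * (1 / ?n ^ (m - 1))" .
  qed
  also have "\<dots> = fact M * (\<Sum>A\<in>?Ms. \<Sum>f | f \<in> ?V \<and> mset f = A. 1 / real (?N (mset f)) ^ (m - 1))"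
    unfolding sum_distrib_left[symmetric]
    by (subst sum.group[OF finite_vecs finite_multisets_of_size[OF finite_carrier]])
      (auto simp: vecs_def)
  \<comment> \<open>Each \<open>A\<close> comes from \<open>?N A\<close> lists \<open>f\<close>,
    which lowers the exponent from \<open>m - 1\<close> to \<open>m - 2\<close>.\<close>
  also have "(\<Sum>A\<in>?Ms. \<Sum>f | f \<in> ?V \<and> mset f = A. 1 / real (?N (mset f)) ^ (m - 1)) =
      (\<Sum>A\<in>?Ms. 1 / real (?N A) ^ (m - 2))"
  proof (rule sum.cong[OF refl])
    fix A assume A: "A \<in> ?Ms"
    obtain f where f: "mset f = A" using ex_mset by blast
    hence "f \<in> ?V" using A by (auto simp: vecs_def)
    hence "{g \<in> ?V. mset g = A} = permutations_of_multiset A" using perms_eq f by blast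
    hence "(\<Sum>f | f \<in> ?V \<and> mset f = A. 1 / real (?N (mset f)) ^ (m - 1)) =
        (\<Sum>f\<in>permutations_of_multiset A. 1 / real (?N A) ^ (m - 1))"
      by (intro sum.cong) auto
    moreover have "real (?N A) ^ (m - 1) = real (?N A) * real (?N A) ^ (m - 2)"
      using m by (metis One_nat_def Suc_diff_le diff_Suc_Suc numeral_2_eq_2 power_Suc)
    ultimately show "(\<Sum>f | f \<in> ?V \<and> mset f = A. 1 / real (?N (mset f)) ^ (m - 1)) = 1 / real (?N A) ^ (m - 2)"
      using Npos[of A] by simp
  qed
  finally show ?thesis .
qed

end

subsection \<open>Collision probability and statistical distance\<close>

lemma pmf_bind_shuffle:
  assumes "finite B" "B \<noteq> {}" "\<And>y. y \<in> B \<Longrightarrow> length y = M"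
  shows "pmf (bind_pmf (pmf_of_set B) shuffle_pmf) z =
    (\<Sum>y\<in>B. \<Sum>\<pi> | \<pi> permutes {..<M}. of_bool (permute_list \<pi> y = z)) / (card B * fact M)"
proof -
  have "pmf (shuffle_pmf y) z = (\<Sum>\<pi> | \<pi> permutes {..<M}. of_bool (permute_list \<pi> y = z)) / fact M"
    if "y \<in> B" for y
  proof -
    have len: "length y = M" using assms(3) that .
    have ne: "{\<pi>. \<pi> permutes {..<M}} \<noteq> {}" using permutes_id by blast
    have "shuffle_pmf y = bind_pmf (pmf_of_set {\<pi>. \<pi> permutes {..<M}}) (\<lambda>\<pi>. return_pmf (permute_list \<pi> y))"
      by (simp add: shuffle_pmf_def map_pmf_def len permute_list_def)
    thus ?thesis
      by (simp add: pmf_bind_pmf_of_set[OF ne] finite_permutations card_permutations pmf_return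
          indicator_def of_bool_def)
  qed
  thus ?thesis using assms(1,2)
    by (simp add: pmf_bind_pmf_of_set sum_divide_distrib[symmetric] divide_divide_eq_left mult.commute)
qed

lemma set_bind_shuffle:
  assumes "finite B" "B \<noteq> {}" "\<And>y. y \<in> B \<Longrightarrow> length y = M"
    and "\<And>y \<pi>. y \<in> B \<Longrightarrow> \<pi> permutes {..<M} \<Longrightarrow> permute_list \<pi> y \<in> T"
  shows "set_pmf (bind_pmf (pmf_of_set B) shuffle_pmf) \<subseteq> T"
proof -
  have "{\<pi>. \<pi> permutes {..<M}} \<noteq> {}" using permutes_id by blast
  moreover have "map (\<lambda>k. y ! \<pi> k) [0..<M] \<in> T" if "y \<in> B" "\<pi> permutes {..<M}" for y \<pi>
    using assms(4)[OF that] assms(3)[OF that(1)] by (simp add: permute_list_def)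
  ultimately show ?thesis
    by (auto simp: shuffle_pmf_def assms(1-3) finite_permutations)
qed

text \<open>The output of the shuffle is permutation invariant, so in the collision probability one of
  the two independent samples need not be shuffled.\<close>

lemma sum_pmf_square_bind_shuffle:
  assumes B: "finite B" "B \<noteq> {}" "\<And>y. y \<in> B \<Longrightarrow> length y = M"
    and T: "finite T" "\<And>y \<pi>. y \<in> B \<Longrightarrow> \<pi> permutes {..<M} \<Longrightarrow> permute_list \<pi> y \<in> T"
  shows "(\<Sum>z\<in>T. (pmf (bind_pmf (pmf_of_set B) shuffle_pmf) z)\<^sup>2) =
    (\<Sum>\<pi> | \<pi> permutes {..<M}. real (card {y \<in> B. permute_list \<pi> y \<in> B})) / (real (card B) ^ 2 * fact M)"
proof -
  let ?Pi = "{\<pi>. \<pi> permutes {..<M}}"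
  \<comment> \<open>Up to the factor \<open>card B * fact M\<close>, this is the output probability
    of \<open>z\<close>.\<close>
  define c :: "'a list \<Rightarrow> real" where "c z = (\<Sum>y\<in>B. \<Sum>\<pi>\<in>?Pi. of_bool (permute_list \<pi> y = z))" for z
  have finPi: "finite ?Pi" by (simp add: finite_permutations)
  have c_inv: "c (permute_list \<tau> z) = c z" if \<tau>: "\<tau> permutes {..<M}" and z: "length z = M" for \<tau> z
    unfolding c_def
  proof (rule sum.cong[OF refl])
    fix y assume "y \<in> B"
    hence y: "length y = M" by (rule B(3))
    let ?\<rho> = "inv_into UNIV \<tau>"
    have \<rho>: "?\<rho> permutes {..<M}" by (rule permutes_inv[OF \<tau>])
    show "(\<Sum>\<pi>\<in>?Pi. of_bool (permute_list \<pi> y = permute_list \<tau> z)) =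
        (\<Sum>\<pi>\<in>?Pi. of_bool (permute_list \<pi> y = z) :: real)"
    proof (rule sum.reindex_bij_witness[where i = "\<lambda>\<pi>. \<pi> \<circ> \<tau>" and j = "\<lambda>\<pi>. \<pi> \<circ> ?\<rho>"])
      fix \<pi> assume "\<pi> \<in> ?Pi"
      hence \<pi>: "\<pi> permutes {..<M}" by simp
      show "\<pi> \<circ> ?\<rho> \<circ> \<tau> = \<pi>" "\<pi> \<circ> \<tau> \<circ> ?\<rho> = \<pi>"
        using permutes_inv_o[OF \<tau>] by (simp_all add: comp_assoc)
      show "\<pi> \<circ> ?\<rho> \<in> ?Pi" "\<pi> \<circ> \<tau> \<in> ?Pi"
        using \<pi> \<tau> \<rho> by (simp_all add: permutes_compose)
      have "permute_list (\<pi> \<circ> ?\<rho>) y = permute_list ?\<rho> (permute_list \<pi> y)"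
        using \<rho> y by (simp add: permute_list_compose)
      moreover have "permute_list ?\<rho> (permute_list \<tau> z) = z"
        using permutes_inv_o(1)[OF \<tau>] \<rho> z by (simp flip: permute_list_compose)
      moreover have "permute_list \<tau> (permute_list ?\<rho> (permute_list \<pi> y)) = permute_list \<pi> y"
        using permutes_inv_o(2)[OF \<tau>] \<tau> y by (simp flip: permute_list_compose[of \<tau>])
      ultimately have "permute_list (\<pi> \<circ> ?\<rho>) y = z \<longleftrightarrow> permute_list \<pi> y = permute_list \<tau> z"
        by metis
      thus "of_bool (permute_list (\<pi> \<circ> ?\<rho>) y = z) =
          (of_bool (permute_list \<pi> y = permute_list \<tau> z) :: real)"
        by (simp only:)
    qed
  qed
  \<comment> \<open>Only one factor of the square is expanded. The sum over \<open>z\<close> then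
    evaluates the other at \<open>permute_list \<pi> y\<close>, and \<open>c_inv\<close> removes
    that permutation.\<close>
  have "(\<Sum>z\<in>T. c z ^ 2) = (\<Sum>z\<in>T. \<Sum>y\<in>B. \<Sum>\<pi>\<in>?Pi. of_bool (permute_list \<pi> y = z) * c z)"
    by (simp add: power2_eq_square sum_distrib_right) (simp add: c_def sum_distrib_right)
  also have "\<dots> = (\<Sum>y\<in>B. \<Sum>z\<in>T. \<Sum>\<pi>\<in>?Pi. of_bool (permute_list \<pi> y = z) * c z)"
    by (rule sum.swap)
  also have "\<dots> = (\<Sum>y\<in>B. \<Sum>\<pi>\<in>?Pi. \<Sum>z\<in>T. of_bool (permute_list \<pi> y = z) * c z)"
    by (intro sum.cong refl sum.swap)
  also have "\<dots> = (\<Sum>y\<in>B. \<Sum>\<pi>\<in>?Pi. c y)"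
  proof (intro sum.cong refl)
    fix y \<pi> assume y: "y \<in> B" and \<pi>: "\<pi> \<in> ?Pi"
    have "(\<Sum>z\<in>T. of_bool (permute_list \<pi> y = z) * c z) = c (permute_list \<pi> y)"
      using T(1) T(2)[OF y] \<pi> by (simp add: of_bool_def if_distrib[of "\<lambda>x. x * _"] sum.delta' cong: if_cong)
    thus "(\<Sum>z\<in>T. of_bool (permute_list \<pi> y = z) * c z) = c y"
      using c_inv[of \<pi> y] \<pi> B(3)[OF y] by simp
  qed
  also have "\<dots> = fact M * (\<Sum>y\<in>B. c y)"
    by (simp add: card_permutations sum_distrib_left)
  also have "(\<Sum>y\<in>B. c y) = (\<Sum>y\<in>B. \<Sum>\<pi>\<in>?Pi. \<Sum>z\<in>B. of_bool (permute_list \<pi> y = z))"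
    unfolding c_def by (subst sum.swap) (intro sum.cong refl sum.swap)
  also have "\<dots> = (\<Sum>y\<in>B. \<Sum>\<pi>\<in>?Pi. of_bool (permute_list \<pi> y \<in> B))"
    using B(1) by (intro sum.cong refl) (simp add: of_bool_def sum.delta' cong: if_cong)
  also have "\<dots> = (\<Sum>\<pi>\<in>?Pi. \<Sum>y\<in>B. of_bool (permute_list \<pi> y \<in> B))"
    by (rule sum.swap)
  also have "\<dots> = (\<Sum>\<pi>\<in>?Pi. real (card {y \<in> B. permute_list \<pi> y \<in> B}))"
    using B(1) by (intro sum.cong refl) (simp add: of_bool_def sum.If_cases Int_def)
  finally have c2: "(\<Sum>z\<in>T. c z ^ 2) = fact M * (\<Sum>\<pi>\<in>?Pi. real (card {y \<in> B. permute_list \<pi> y \<in> B}))" .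
  have pmf_eq: "pmf (bind_pmf (pmf_of_set B) shuffle_pmf) z = c z / (card B * fact M)" for z
    unfolding c_def by (rule pmf_bind_shuffle[OF B])
  have "(\<Sum>z\<in>T. (pmf (bind_pmf (pmf_of_set B) shuffle_pmf) z)\<^sup>2) = (\<Sum>z\<in>T. c z ^ 2) / (card B * fact M)\<^sup>2"
    by (simp add: pmf_eq power_divide sum_divide_distrib)
  also have "\<dots> = (\<Sum>\<pi>\<in>?Pi. real (card {y \<in> B. permute_list \<pi> y \<in> B})) / (real (card B) ^ 2 * fact M)"
    unfolding c2 by (simp add: power2_eq_square)
  finally show ?thesis .
qed

text \<open>Cauchy-Schwarz bounds the squared L1 distance by \<open>card T\<close> times the squared
  L2 distance. Since \<open>p\<close> has total mass 1 on \<open>T\<close>, the latter is the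
  collision probability minus \<open>1 / card T\<close>.\<close>

lemma sum_abs_pmf_minus_uniform_le:
  assumes T: "finite T" "T \<noteq> {}" "set_pmf p \<subseteq> T"
    and \<epsilon>: "\<epsilon> \<ge> 0" "card T * (\<Sum>z\<in>T. (pmf p z)\<^sup>2) \<le> 1 + \<epsilon>\<^sup>2"
  shows "(\<Sum>z\<in>T. \<bar>pmf p z - 1 / card T\<bar>) \<le> \<epsilon>"
proof -
  let ?t = "real (card T)"
  have t: "?t > 0" using T by (simp add: card_gt_0_iff)
  have one: "(\<Sum>z\<in>T. pmf p z) = 1" using T by (intro sum_pmf_eq_1)
  have "(\<Sum>z\<in>T. \<bar>pmf p z - 1 / ?t\<bar>)\<^sup>2 \<le> (\<Sum>z\<in>T. \<bar>pmf p z - 1 / ?t\<bar>\<^sup>2) * ?t"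
    by (rule sum_squared_le_sum_of_squares)
  also have "(\<Sum>z\<in>T. \<bar>pmf p z - 1 / ?t\<bar>\<^sup>2) =
      (\<Sum>z\<in>T. (pmf p z)\<^sup>2) - 2 / ?t * (\<Sum>z\<in>T. pmf p z) + ?t * (1 / ?t)\<^sup>2"
    by (simp add: power2_diff sum.distrib sum_subtractf sum_distrib_left)
  also have "(\<dots>) * ?t = ?t * (\<Sum>z\<in>T. (pmf p z)\<^sup>2) - 1"
    using t by (simp add: one field_simps power2_eq_square)
  also have "\<dots> \<le> \<epsilon>\<^sup>2" using \<epsilon>(2) by simp
  finally show ?thesis using \<epsilon>(1) by (rule power2_le_imp_le)
qed

text \<open>Triangle inequality through the uniform distribution on \<open>T\<close>; the factor 1/2
  in \<open>stat_dist\<close> absorbs the two copies of \<open>\<epsilon>\<close>.\<close>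

lemma stat_dist_le_of_collision:
  assumes T: "finite T" "T \<noteq> {}" "set_pmf p \<subseteq> T" "set_pmf p' \<subseteq> T"
    and \<epsilon>: "\<epsilon> \<ge> 0" "card T * (\<Sum>z\<in>T. (pmf p z)\<^sup>2) \<le> 1 + \<epsilon>\<^sup>2"
      "card T * (\<Sum>z\<in>T. (pmf p' z)\<^sup>2) \<le> 1 + \<epsilon>\<^sup>2"
  shows "stat_dist p p' \<le> \<epsilon>"
proof -
  have "pmf p z = 0" "pmf p' z = 0" if "z \<notin> T" for z
    using T(3,4) that by (auto simp: set_pmf_iff subset_iff)
  hence "(\<Sum>\<^sub>\<infinity>z. \<bar>pmf p z - pmf p' z\<bar>) = (\<Sum>\<^sub>\<infinity>z\<in>T. \<bar>pmf p z - pmf p' z\<bar>)"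
    by (intro infsum_cong_neutral) auto
  also have "\<dots> = (\<Sum>z\<in>T. \<bar>pmf p z - pmf p' z\<bar>)" using T(1) by simp
  also have "\<dots> \<le> (\<Sum>z\<in>T. \<bar>pmf p z - 1 / card T\<bar> + \<bar>pmf p' z - 1 / card T\<bar>)"
    by (intro sum_mono) linarith
  also have "\<dots> \<le> \<epsilon> + \<epsilon>"
    unfolding sum.distrib using T \<epsilon> by (intro add_mono sum_abs_pmf_minus_uniform_le)
  finally show ?thesis by (simp add: stat_dist_def)
qed

section \<open>Security of the protocol and the choice of the constant\<close>

context finite_field
begin

lemma rsum_eq_dot: "u \<in> vecs R N \<Longrightarrow> rsum R u = dot R u (replicate N \<one>)"
  using dot_replicate[of u \<one>] by (auto simp: vecs_def rsum_closed)

lemma inflate_replicate: "inflate m (replicate n a) = replicate (m * n) a"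
  by (induction n) (auto simp: replicate_add)

text \<open>The all-ones vector is block-constant, so by transposition the sum of all messages is
  the sum of the inputs. Thus inputs of equal sum have outputs in a common set.\<close>

lemma block_fibre_subset_shares: "block_fibre R m x \<subseteq> shares R (m * length x) (rsum R x)"
proof
  fix y assume y: "y \<in> block_fibre R m x"
  let ?n = "length x"
  have yv: "y \<in> vecs R (m * ?n)" and x: "block_sums R m ?n y = x" using y by (auto simp: block_fibre_def)
  hence xv: "x \<in> vecs R ?n" using block_sums_in_vecs by metis
  have "rsum R y = dot R y (inflate m (replicate ?n \<one>))"
    using rsum_eq_dot[OF yv] by (simp add: inflate_replicate)
  also have "\<dots> = dot R (block_sums R m ?n y) (replicate ?n \<one>)"
    using yv by (intro dot_block_sums[symmetric]) (auto simp: vecs_def)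
  also have "\<dots> = rsum R x" using rsum_eq_dot[OF xv] x by simp
  finally show "y \<in> shares R (m * ?n) (rsum R x)" using yv by (simp add: shares_def vecs_def)
qed

lemma permute_in_shares:
  "\<pi> permutes {..<M} \<Longrightarrow> y \<in> shares R M s \<Longrightarrow> permute_list \<pi> y \<in> shares R M s"
  using rsum_mset_cong[of "permute_list \<pi> y" y] by (auto simp: shares_def)

lemma split_mix_collision_le:
  assumes m: "m \<ge> 2" and n: "length x = n" "n > 0" and x: "set x \<subseteq> carrier R"
    and k: "2 * k \<le> m - 2"
    and r: "r = real q * real n ^ 2 / real n ^ k" "r \<le> 1 / 2"
  defines "T \<equiv> shares R (m * n) (rsum R x)"
  shows "set_pmf (split_mix R m x) \<subseteq> T"
    and "card T * (\<Sum>z\<in>T. (pmf (split_mix R m x) z)\<^sup>2) \<le> 1 + 2 * r"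
proof -
  let ?B = "block_fibre R m x" and ?M = "m * n"
  let ?Pi = "{\<pi>. \<pi> permutes {..<?M}}"
  have m0: "m > 0" using m by simp
  note p = split_mix_def[of R m x, unfolded split_all_eq[OF m0 x]]
  have B: "finite ?B" "?B \<noteq> {}" "\<And>y. y \<in> ?B \<Longrightarrow> length y = ?M"
    by (fact finite_block_fibre, fact block_fibre_nonempty[OF m0 x])
      (simp add: block_fibre_def vecs_def n(1))
  have finT: "finite T" by (simp add: T_def finite_shares)
  have BT: "permute_list \<pi> y \<in> T" if "y \<in> ?B" "\<pi> permutes {..<?M}" for y \<pi>
    using block_fibre_subset_shares[of m x] permute_in_shares[OF that(2)] that(1)
    by (auto simp: T_def n(1))
  show "set_pmf (split_mix R m x) \<subseteq> T"
    unfolding p by (rule set_bind_shuffle[OF B BT])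
  let ?E = "\<lambda>\<pi>. real (card {y \<in> ?B. permute_list \<pi> y \<in> ?B})"
  let ?K = "\<lambda>\<pi>. real (card {(f, g). f \<in> vecs R n \<and> g \<in> vecs R n
      \<and> permute_list \<pi> (inflate m f) = inflate m g})"
  define Q where "Q = real q"
  have Q: "Q > 0" using card_carrier_ge_2 by (simp add: Q_def)
  have "q * card T = q ^ ?M"
    unfolding T_def using m n x by (intro card_shares) (auto intro: rsum_closed)
  hence "real (q * card T) = real (q ^ ?M)" by (simp only:)
  hence cT: "real (card T) = Q ^ ?M / Q" using Q by (simp add: Q_def field_simps)
  have "q ^ n * card ?B = q ^ ?M"
    using card_block_fibre[OF m0 x] n by simp
  hence "real (q ^ n * card ?B) = real (q ^ ?M)" by (simp only:)
  hence cB: "real (card ?B) = Q ^ ?M / Q ^ n" using Q by (simp add: Q_def field_simps)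
  have EK: "?E \<pi> \<le> ?K \<pi> * (Q ^ ?M / Q ^ (2 * n))" if "\<pi> \<in> ?Pi" for \<pi>
  proof -
    have "real (card {y \<in> ?B. permute_list \<pi> y \<in> ?B} * q ^ (2 * n))
        \<le> real (card {(f, g). f \<in> vecs R n \<and> g \<in> vecs R n
            \<and> permute_list \<pi> (inflate m f) = inflate m g} * q ^ ?M)"
      using card_block_fibre_permute_le[OF m0 x, of ?M \<pi>] that n(1)
      by (simp only: of_nat_le_iff mem_Collect_eq)
    hence "?E \<pi> * Q ^ (2 * n) \<le> ?K \<pi> * Q ^ ?M"
      by (simp only: of_nat_mult of_nat_power Q_def)
    thus ?thesis using Q by (simp add: pos_le_divide_eq)
  qed
  have K: "(\<Sum>\<pi>\<in>?Pi. ?K \<pi>) \<le> fact ?M * (Q * (1 + 2 * r))"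
  proof (rule order.trans[OF sum_card_agreeing_labellings_le[OF m refl]])
    show "fact ?M * (\<Sum>A | size A = n \<and> set_mset A \<subseteq> carrier R.
        1 / real (card (permutations_of_multiset A)) ^ (m - 2)) \<le> fact ?M * (Q * (1 + 2 * r))"
      unfolding Q_def
      by (intro mult_left_mono sum_inverse_card_permutations_le[OF finite_carrier n(2) k r]) simp
  qed
  have "(\<Sum>\<pi>\<in>?Pi. ?E \<pi>) \<le> (\<Sum>\<pi>\<in>?Pi. ?K \<pi>) * (Q ^ ?M / Q ^ (2 * n))"
    unfolding sum_distrib_right by (rule sum_mono) (rule EK)
  also have "\<dots> \<le> fact ?M * (Q * (1 + 2 * r)) * (Q ^ ?M / Q ^ (2 * n))"
    using Q by (intro mult_right_mono K) auto
  finally have E: "(\<Sum>\<pi>\<in>?Pi. ?E \<pi>) \<le> fact ?M * (Q * (1 + 2 * r)) * (Q ^ ?M / Q ^ (2 * n))" .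
  have "card T * (\<Sum>z\<in>T. (pmf (split_mix R m x) z)\<^sup>2) =
      card T * ((\<Sum>\<pi>\<in>?Pi. ?E \<pi>) / (real (card ?B) ^ 2 * fact ?M))"
    unfolding p by (subst sum_pmf_square_bind_shuffle[OF B finT BT]) auto
  also have "\<dots> \<le> card T * (fact ?M * (Q * (1 + 2 * r)) * (Q ^ ?M / Q ^ (2 * n)) / (real (card ?B) ^ 2 * fact ?M))"
    by (intro mult_left_mono divide_right_mono E) auto
  \<comment> \<open>The factor \<open>Q\<close> contributed by the constant multisets cancels
    exactly against the \<open>1 / Q\<close> in the size of \<open>T\<close>; the other powers of
    \<open>Q\<close> cancel through the size of \<open>?B\<close>.\<close>
  also have "\<dots> = 1 + 2 * r"
  proof -
    have "Q ^ (2 * n) = (Q ^ n)\<^sup>2" by (metis mult.commute power_mult)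
    moreover have "P / Q * (F * (Q * s) * (P / N\<^sup>2) / ((P / N)\<^sup>2 * F)) = s"
      if "P > 0" "F > 0" "N > 0" for P F N s :: real
      using that Q by (simp add: power2_eq_square)
    ultimately show ?thesis unfolding cT cB using Q by simp
  qed
  finally show "card T * (\<Sum>z\<in>T. (pmf (split_mix R m x) z)\<^sup>2) \<le> 1 + 2 * r" .
qed

lemma stat_dist_split_mix_le:
  assumes n: "n \<ge> 2" and "\<sigma> > 0"
    and m: "real m \<ge> 9 * (1 + (\<sigma> + log 2 (real q)) / log 2 (real n))"
    and len: "length x = n" "length x' = n"
    and x: "set x \<subseteq> carrier R" "set x' \<subseteq> carrier R" "rsum R x = rsum R x'"
  shows "stat_dist (split_mix R m x) (split_mix R m x') \<le> 2 powr (- \<sigma>)"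
proof -
  define L where "L = log 2 (real n)"
  define l where "l = log 2 (real q)"
  have L: "L \<ge> 1" using n by (simp add: L_def le_log_iff)
  have l: "l \<ge> 1" using card_carrier_ge_2 by (simp add: l_def le_log_iff)
  have nL: "real n = 2 powr L" using n by (simp add: L_def)
  have ql: "real q = 2 powr l" using card_carrier_ge_2 by (simp add: l_def)
  have m': "9 * (1 + (\<sigma> + l) / L) \<le> real m" using m by (simp only: L_def l_def)
  moreover have "(\<sigma> + l) / L \<ge> 0" using L l \<open>\<sigma> > 0\<close> by simp
  ultimately have "real m \<ge> 9" by argo
  hence m9: "m \<ge> 9" by linarith
  define k where "k = (m - 2) div 2"
  define r where "r = real q * real n ^ 2 / real n ^ k"
  \<comment> \<open>The 3 is the subtracted 2 plus a possible loss of 1 from halving.\<close>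
  have "real m \<le> 2 * real k + 3" using m9 unfolding k_def by linarith
  hence "9 * (1 + (\<sigma> + l) / L) \<le> 2 * real k + 3" using m' by linarith
  hence "9 * (1 + (\<sigma> + l) / L) * L \<le> (2 * real k + 3) * L" using L by (intro mult_right_mono) auto
  moreover have "9 * (1 + (\<sigma> + l) / L) * L = 9 * (L + \<sigma> + l)" using L by (simp add: field_simps)
  \<comment> \<open>Twice the claim asks for \<open>2 + 2 * l + 4 * L + 4 * \<sigma>\<close>. The
    term \<open>9 * L\<close> splits into \<open>3 * L\<close> for the rounding,
    \<open>4 * L\<close>, and \<open>2 * L\<close>, which is at least 2; this is where the constant
    9 comes from.\<close>
  ultimately have kL: "real k * L \<ge> 1 + l + 2 * L + 2 * \<sigma>" using L l \<open>\<sigma> > 0\<close> by (simp add: algebra_simps)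
  have "r = 2 powr l * 2 powr (2 * L) / 2 powr (real k * L)"
    unfolding r_def ql nL by (simp add: powr_powr flip: powr_realpow) (simp add: mult.commute)
  also have "\<dots> = 2 powr (l + 2 * L - real k * L)" by (simp add: powr_add powr_diff)
  \<comment> \<open>The exponent is chosen so that \<open>2 * r\<close> is at most the square of
    \<open>2 powr (- \<sigma>)\<close>.\<close>
  also have "\<dots> \<le> 2 powr (- 1 - 2 * \<sigma>)" using kL by (intro powr_mono) auto
  finally have r: "r \<le> 2 powr (- 1 - 2 * \<sigma>)" .
  also have "\<dots> \<le> 2 powr (-1)" using \<open>\<sigma> > 0\<close> by (intro powr_mono) auto
  finally have r_half: "r \<le> 1 / 2" by (simp add: powr_minus_divide)
  have "2 powr (- 1 - 2 * \<sigma>) = (2 powr (- \<sigma>))\<^sup>2 / 2"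
    by (simp add: powr_diff powr_minus_divide power2_eq_square flip: powr_add)
  hence r_sq: "1 + 2 * r \<le> 1 + (2 powr (- \<sigma>))\<^sup>2" using r by simp
  have k2: "2 * k \<le> m - 2" by (simp add: k_def)
  have m2: "m \<ge> 2" and n0: "n > 0" using m9 n by auto
  note c = split_mix_collision_le[OF m2 len(1) n0 x(1) k2 r_def r_half]
  \<comment> \<open>Folding the equality of sums makes both collision bounds refer to the same set
    of tuples.\<close>
  note c' = split_mix_collision_le[OF m2 len(2) n0 x(2) k2 r_def r_half, folded x(3)]
  have "shares R (m * n) (rsum R x) \<noteq> {}" 
    using c(1) set_pmf_not_empty[of "split_mix R m x"] by auto
  thus ?thesis
    by (rule stat_dist_le_of_collision[OF finite_shares _ c(1) c'(1) _
          order.trans[OF c(2) r_sq] order.trans[OF c'(2) r_sq]]) simp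
qed

end

theorem theorem1:
  shows "\<exists>C::real. C > 0 \<and>
    (\<forall>(R :: nat ring) (n::nat) (\<sigma>::real) (m::nat) (x::nat list) (x'::nat list).
       field R \<longrightarrow> finite (carrier R) \<longrightarrow> n \<ge> 2 \<longrightarrow> \<sigma> > 0 \<longrightarrow>
       real m \<ge> C * (1 + (\<sigma> + log 2 (real (card (carrier R)))) / log 2 (real n)) \<longrightarrow>
       length x = n \<longrightarrow> length x' = n \<longrightarrow>
       set x \<subseteq> carrier R \<longrightarrow> set x' \<subseteq> carrier R \<longrightarrow>
       rsum R x = rsum R x' \<longrightarrow>
       stat_dist (split_mix R m x) (split_mix R m x') \<le> 2 powr (- \<sigma>))"
  by (rule exI[of _ 9])
    (auto intro!: finite_field.stat_dist_split_mix_le finite_field.intro finite_field_axioms.intro)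

end
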